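(* There exist an absolute constant $C>0$ and an algorithm (the "basic procedure") with the following property. The input consists of a cone $\mathcal K=\mathcal K_1\times\cdots\times\mathcal K_n\subset\mathbb R^{\bar n}$, where each $\mathcal K_i\subseteq\mathbb R^{d_i}$ is a half-line ($d_i=1$) or a second-order cone ($d_i\ge 2$) and $\bar n=\sum_{i=1}^n d_i$, a matrix $A\in\mathbb R^{m\times\bar n}$ with linearly independent rows, and a vector $y^{in}\in\mathrm{int}(\mathcal K)$ with $e^Ty^{in}=1$. Using at most $$C\bigl(n^3\,\bar n\,\max_i d_i+m\,\bar n^2\bigr)$$ arithmetic operations, the algorithm terminates and returns one of the following: (i) a cut generating vector with its generating index, i.e. a vector $y\in\mathrm{int}(\mathcal K)$ with $e^Ty=1$ and an index $k\in\{1,\dots,n\}$ such that $2\sqrt n\,\|P_Ay\|\le y_{k0}$; (ii) a vector $x\in\mathrm{int}(\mathcal K)$ with $Ax=0$; (iii) a nonzero vector $y\in\mathcal K$ with $y=A^Tu$ for some $u\in\mathbb R^m$.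
   Context: A half-line is $\{x\in\mathbb R: x\ge 0\}$; the second-order cone in $\mathbb R^{d}$, $d\ge2$, is $\{(x_0;x_1)\in\mathbb R\times\mathbb R^{d-1}:\|x_1\|\le x_0\}$ with the Euclidean norm. Vectors $x\in\mathbb R^{\bar n}$ are split into blocks $x=(x_1;\dots;x_n)$, $x_i\in\mathbb R^{d_i}$; for a second-order cone block $x_i=(x_{i0};x_{i1})\in\mathbb R\times\mathbb R^{d_i-1}$, and for a half-line block $x_{i0}$ means $x_i$. $e=(e_1;\dots;e_n)$ with $e_i=1$ if $d_i=1$ and $e_i=(1;0)\in\mathbb R\times\mathbb R^{d_i-1}$ if $d_i\ge2$. $P_A=I-A^T(AA^T)^{-1}A$ is the orthogonal projection onto $\mathrm{Ker}(A)$. The model of computation is exact real arithmetic: additions, subtractions, multiplications, divisions, square roots and comparisons of real numbers each count as one arithmetic operation. *)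

theory Defs
  imports
    Complex_Main
    "Jordan_Normal_Form.Gauss_Jordan_Elimination"
    "Jordan_Normal_Form.VS_Connect"
begin

section \<open>Products of half-lines and second-order cones\<close>

text \<open>
  A cone is described by the list of its block dimensions: a block of dimension 1 is a
  half-line, a block of dimension at least 2 is a second-order cone. Blocks and coordinates are
  numbered from 0, so that the blocks of \<open>ds\<close> are those with index \<open>i < length ds\<close>.
\<close>

definition vec_norm :: "real vec \<Rightarrow> real" where
  "vec_norm v = sqrt (v \<bullet> v)"

definition half_line :: "real vec set" where
  "half_line = {x \<in> carrier_vec 1. x $ 0 \<ge> 0}"

definition second_order_cone :: "nat \<Rightarrow> real vec set" where
  "second_order_cone d =
     {x \<in> carrier_vec d. vec_norm (vec (d - 1) (\<lambda>j. x $ Suc j)) \<le> x $ 0}"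

definition block_cone :: "nat \<Rightarrow> real vec set" where
  "block_cone d = (if d = 1 then half_line else second_order_cone d)"

definition offset :: "nat list \<Rightarrow> nat \<Rightarrow> nat" where
  "offset ds i = sum_list (take i ds)"

definition block :: "nat list \<Rightarrow> nat \<Rightarrow> real vec \<Rightarrow> real vec" where
  "block ds i x = vec (ds ! i) (\<lambda>j. x $ (offset ds i + j))"

definition cone :: "nat list \<Rightarrow> real vec set" where
  "cone ds = {x \<in> carrier_vec (sum_list ds). \<forall>i < length ds. block ds i x \<in> block_cone (ds ! i)}"

text \<open>The topological interior of a subset of Euclidean \<open>N\<close>-space.\<close>

definition vec_interior :: "nat \<Rightarrow> real vec set \<Rightarrow> real vec set" where
  "vec_interior N S =
     {x \<in> carrier_vec N. \<exists>\<epsilon>>0. \<forall>y \<in> carrier_vec N. vec_norm (y - x) < \<epsilon> \<longrightarrow> y \<in> S}"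

text \<open>\<open>unit_vec d 0\<close> is 1 for \<open>d = 1\<close> and \<open>(1; 0)\<close> for \<open>d \<ge> 2\<close>.\<close>

definition cone_unit :: "nat list \<Rightarrow> real vec" where
  "cone_unit ds = foldr (\<lambda>d v. unit_vec d 0 @\<^sub>v v) ds (vec 0 (\<lambda>_. 0))"

definition lin_indep_rows :: "real mat \<Rightarrow> bool" where
  "lin_indep_rows A \<longleftrightarrow>
     distinct (rows A) \<and>
     \<not> module.lin_dep class_ring (module_vec TYPE(real) (dim_col A)) (set (rows A))"

definition kernel_projection :: "real mat \<Rightarrow> real mat" where
  "kernel_projection A =
     1\<^sub>m (dim_col A) - A\<^sup>T * the (mat_inverse (A * A\<^sup>T)) * A"


section \<open>Exact real arithmetic\<close>

text \<open>
  A uniform random access machine given as a structured programming language. Memory consists of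
  named arrays of natural numbers, used for sizes, indices and control, and named arrays of real
  numbers; both are addressed by expressions over the natural numbers. Only operations on real
  numbers (addition, subtraction, multiplication, division, square root, comparison) are counted.
  The only real constants in programs are natural number literals. Real numbers influence the
  control flow and the natural number memory only through counted comparisons, and there is no
  conversion between the two kinds of memory.
\<close>

record store =
  nats :: "string \<Rightarrow> nat \<Rightarrow> nat"
  reals :: "string \<Rightarrow> nat \<Rightarrow> real"

datatype nexp =
    NNum nat
  | NCell string nexp
  | NAdd nexp nexp
  | NSub nexp nexp
  | NMul nexp nexp

datatype bexp =
    BLess nexp nexp
  | BNot bexp
  | BAnd bexp bexp

datatype rexp =
    RNum nat
  | RCell string nexp
  | RAdd rexp rexp
  | RSub rexp rexp
  | RMul rexp rexp
  | RDiv rexp rexp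
  | RSqrt rexp

datatype com =
    Skip
  | NAssign string nexp nexp
  | RAssign string nexp rexp
  | Compare string nexp rexp rexp
  | Seq com com
  | If bexp com com
  | While bexp com

fun nval :: "store \<Rightarrow> nexp \<Rightarrow> nat" where
  "nval s (NNum k) = k"
| "nval s (NCell a i) = nats s a (nval s i)"
| "nval s (NAdd p q) = nval s p + nval s q"
| "nval s (NSub p q) = nval s p - nval s q"
| "nval s (NMul p q) = nval s p * nval s q"

fun bval :: "store \<Rightarrow> bexp \<Rightarrow> bool" where
  "bval s (BLess p q) \<longleftrightarrow> nval s p < nval s q"
| "bval s (BNot b) \<longleftrightarrow> \<not> bval s b"
| "bval s (BAnd b c) \<longleftrightarrow> bval s b \<and> bval s c"

fun rval :: "store \<Rightarrow> rexp \<Rightarrow> real" where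
  "rval s (RNum k) = real k"
| "rval s (RCell a i) = reals s a (nval s i)"
| "rval s (RAdd p q) = rval s p + rval s q"
| "rval s (RSub p q) = rval s p - rval s q"
| "rval s (RMul p q) = rval s p * rval s q"
| "rval s (RDiv p q) = rval s p / rval s q"
| "rval s (RSqrt p) = sqrt (rval s p)"

text \<open>
  Division by zero and square roots of negative numbers are total functions in HOL; the machine
  must not exploit this, so a program that attempts them has no execution.
\<close>

fun rdefined :: "store \<Rightarrow> rexp \<Rightarrow> bool" where
  "rdefined s (RNum k) \<longleftrightarrow> True"
| "rdefined s (RCell a i) \<longleftrightarrow> True"
| "rdefined s (RAdd p q) \<longleftrightarrow> rdefined s p \<and> rdefined s q"
| "rdefined s (RSub p q) \<longleftrightarrow> rdefined s p \<and> rdefined s q"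
| "rdefined s (RMul p q) \<longleftrightarrow> rdefined s p \<and> rdefined s q"
| "rdefined s (RDiv p q) \<longleftrightarrow> rdefined s p \<and> rdefined s q \<and> rval s q \<noteq> 0"
| "rdefined s (RSqrt p) \<longleftrightarrow> rdefined s p \<and> rval s p \<ge> 0"

fun rops :: "rexp \<Rightarrow> nat" where
  "rops (RNum k) = 0"
| "rops (RCell a i) = 0"
| "rops (RAdd p q) = rops p + rops q + 1"
| "rops (RSub p q) = rops p + rops q + 1"
| "rops (RMul p q) = rops p + rops q + 1"
| "rops (RDiv p q) = rops p + rops q + 1"
| "rops (RSqrt p) = rops p + 1"

definition nwrite :: "string \<Rightarrow> nat \<Rightarrow> nat \<Rightarrow> store \<Rightarrow> store" where
  "nwrite a i v s = s\<lparr>nats := (nats s)(a := (nats s a)(i := v))\<rparr>"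

definition rwrite :: "string \<Rightarrow> nat \<Rightarrow> real \<Rightarrow> store \<Rightarrow> store" where
  "rwrite a i v s = s\<lparr>reals := (reals s)(a := (reals s a)(i := v))\<rparr>"

text \<open>
  \<open>exec c s t s'\<close>: started in \<open>s\<close>, the program \<open>c\<close> terminates in \<open>s'\<close> after exactly \<open>t\<close>
  arithmetic operations. The relation is deterministic, so the existence of \<open>t\<close> and \<open>s'\<close> means
  that the run of \<open>c\<close> from \<open>s\<close> terminates.
\<close>

inductive exec :: "com \<Rightarrow> store \<Rightarrow> nat \<Rightarrow> store \<Rightarrow> bool" where
  Skip: "exec Skip s 0 s"
| NAssign: "exec (NAssign a i p) s 0 (nwrite a (nval s i) (nval s p) s)"
| RAssign: "rdefined s p \<Longrightarrow> exec (RAssign a i p) s (rops p) (rwrite a (nval s i) (rval s p) s)"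
| Compare: "rdefined s p \<Longrightarrow> rdefined s q \<Longrightarrow>
    exec (Compare a i p q) s (rops p + rops q + 1)
      (nwrite a (nval s i) (if rval s p \<le> rval s q then 1 else 0) s)"
| Seq: "exec c s t s' \<Longrightarrow> exec c' s' t' s'' \<Longrightarrow> exec (Seq c c') s (t + t') s''"
| IfTrue: "bval s b \<Longrightarrow> exec c s t s' \<Longrightarrow> exec (If b c c') s t s'"
| IfFalse: "\<not> bval s b \<Longrightarrow> exec c' s t s' \<Longrightarrow> exec (If b c c') s t s'"
| WhileFalse: "\<not> bval s b \<Longrightarrow> exec (While b c) s 0 s"
| WhileTrue: "bval s b \<Longrightarrow> exec c s t s' \<Longrightarrow> exec (While b c) s' t' s'' \<Longrightarrow>
    exec (While b c) s (t + t') s''"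

inductive_cases SkipE: "exec Skip s t s'"
inductive_cases NAssignE: "exec (NAssign a i p) s t s'"
inductive_cases RAssignE: "exec (RAssign a i p) s t s'"
inductive_cases CompareE: "exec (Compare a i p q) s t s'"
inductive_cases SeqE: "exec (Seq c c') s t s'"
inductive_cases IfE: "exec (If b c c') s t s'"
inductive_cases WhileE: "exec (While b c) s t s'"

lemma exec_deterministic:
  "exec c s t s' \<Longrightarrow> exec c s u s'' \<Longrightarrow> u = t \<and> s'' = s'"
proof (induction arbitrary: u s'' rule: exec.induct)
  case (Skip s)
  from Skip.prems show ?case by (rule SkipE) simp
next
  case (NAssign a i p s)
  from NAssign.prems show ?case by (rule NAssignE) simp
next
  case (RAssign s p a i)
  from RAssign.prems show ?case by (rule RAssignE) simp
next
  case (Compare s p q a i)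
  from Compare.prems show ?case by (rule CompareE) simp
next
  case (Seq c s t s1 c' t' s2)
  from Seq.prems show ?case by (rule SeqE) (metis Seq.IH)
next
  case (IfTrue s b c t s1 c')
  from IfTrue.prems show ?case by (rule IfE) (use IfTrue in metis)+
next
  case (IfFalse s b c' t s1 c)
  from IfFalse.prems show ?case by (rule IfE) (use IfFalse in metis)+
next
  case (WhileFalse s b c)
  from WhileFalse.prems show ?case by (rule WhileE) (use WhileFalse.hyps in simp_all)
next
  case (WhileTrue s b c t s1 t' s2)
  from WhileTrue.prems show ?case by (rule WhileE) (metis WhileTrue.hyps(1) WhileTrue.IH)+
qed


section \<open>Input and output of the basic procedure\<close>

definition valid_input :: "nat list \<Rightarrow> nat \<Rightarrow> real mat \<Rightarrow> real vec \<Rightarrow> bool" where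
  "valid_input ds m A y_in \<longleftrightarrow>
     (\<forall>d \<in> set ds. d \<ge> 1) \<and>
     A \<in> carrier_mat m (sum_list ds) \<and> lin_indep_rows A \<and>
     y_in \<in> vec_interior (sum_list ds) (cone ds) \<and> cone_unit ds \<bullet> y_in = 1"

text \<open>The matrix is stored row by row; all memory not holding input is initially 0.\<close>

definition input_store :: "nat list \<Rightarrow> real mat \<Rightarrow> real vec \<Rightarrow> store" where
  "input_store ds A y_in =
     \<lparr>nats = (\<lambda>a i.
        if a = ''n'' \<and> i = 0 then length ds
        else if a = ''m'' \<and> i = 0 then dim_row A
        else if a = ''d'' \<and> i < length ds then ds ! i
        else 0),
      reals = (\<lambda>a i.
        if a = ''A'' \<and> i < dim_row A * dim_col A then A $$ (i div dim_col A, i mod dim_col A)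
        else if a = ''y'' \<and> i < dim_vec y_in then y_in $ i
        else 0)\<rparr>"

definition output_case :: "store \<Rightarrow> nat" where
  "output_case s = nats s ''case'' 0"

definition output_index :: "store \<Rightarrow> nat" where
  "output_index s = nats s ''k'' 0"

definition output_vec :: "nat \<Rightarrow> store \<Rightarrow> real vec" where
  "output_vec N s = vec N (reals s ''out'')"

definition cut_generating :: "nat list \<Rightarrow> real mat \<Rightarrow> real vec \<Rightarrow> nat \<Rightarrow> bool" where
  "cut_generating ds A y k \<longleftrightarrow>
     y \<in> vec_interior (sum_list ds) (cone ds) \<and> cone_unit ds \<bullet> y = 1 \<and> k < length ds \<and>
     2 * sqrt (real (length ds)) * vec_norm (kernel_projection A *\<^sub>v y) \<le> y $ offset ds k"

end

(*
  A perceptron (von Neumann) iteration with z = P_A y. If some block of z is not in the interior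
  of its cone, there is a boundary point c of that cone with e^T c = 1, |c|^2 = 2 (or c = e_k) and
  <c, z> <= 0; replacing y by y + c keeps y interior, raises e^T y by 1, and raises |z|^2 by at most
  |P_A c|^2 <= 2, because <z, P_A c> = <z, c>. Since |z|^2 <= 2 holds initially, after 8 n^3 steps
  |z|^2 <= 2 (8 n^3 + 1) while e^T y = 8 n^3 + 1, and the normalised y generates a cut in the block
  where y_k0 is largest. If instead z is interior, it solves A z = 0; alternative (iii) never occurs.
  Each update of z uses only the d_k columns of P_A belonging to one block, hence costs 2 N d_k,
  and P_A itself is built from the identity by one rank-one update per row of A.
*)

theory Submission
  imports Defs "HOL-Analysis.L2_Norm" "Jordan_Normal_Form.DL_Rank"
begin

section \<open>Orthogonal projections\<close>

text \<open>The budget leaves about \<open>N * D\<close> operations per iteration (\<open>D\<close>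
  the largest block dimension). Recomputing \<open>P_A y\<close> would take order
  \<open>N^2\<close>, too much by up to a factor \<open>n\<close>, so \<open>z\<close> is carried
  along and corrected. Only the first product costs \<open>2 * N^2\<close>, which
  \<open>N <= n * D\<close> absorbs. The count \<open>8 * n^3\<close> balances two estimates at
  total mass \<open>T\<close>. The largest head coordinate of \<open>y\<close> is at least the
  average \<open>T / n\<close>, while \<open>2 * sqrt n * |z| <= sqrt (8 * n * T)\<close>; the
  second number is at most the first exactly when \<open>8 * n^3 <= T\<close>. The other obstacle is
  definedness. A program that divides by zero has no execution, so independence of the rows of
  \<open>A\<close> has to be turned into nonvanishing of every pivot \<open>|P a_r|^2\<close>. The
  matrix obtained from these pivots must then be recognised as the projection defined through the
  inverse Gram matrix, which the program never forms.\<close>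

definition app :: "nat \<Rightarrow> (nat \<Rightarrow> nat \<Rightarrow> real) \<Rightarrow> (nat \<Rightarrow> real) \<Rightarrow> nat \<Rightarrow> real" where
  "app N P x i = (\<Sum>j<N. P i j * x j)"

definition orth_proj :: "nat \<Rightarrow> (nat \<Rightarrow> nat \<Rightarrow> real) \<Rightarrow> bool" where
  "orth_proj N P \<longleftrightarrow> (\<forall>i<N. \<forall>j<N. P i j = P j i) \<and>
     (\<forall>i<N. \<forall>j<N. (\<Sum>k<N. P i k * P k j) = P i j)"

lemma orth_proj_sym: "orth_proj N P \<Longrightarrow> i < N \<Longrightarrow> j < N \<Longrightarrow> P i j = P j i"
  by (simp add: orth_proj_def)

lemma orth_proj_idem: "orth_proj N P \<Longrightarrow> i < N \<Longrightarrow> j < N \<Longrightarrow> (\<Sum>k<N. P i k * P k j) = P i j"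
  unfolding orth_proj_def by blast

lemma app_add: "app N P (\<lambda>j. x j + y j) i = app N P x i + app N P y i"
  by (simp add: app_def distrib_left sum.distrib)

lemma app_app:
  assumes "orth_proj N P" "i < N"
  shows "app N P (app N P x) i = app N P x i"
proof -
  have "app N P (app N P x) i = (\<Sum>k<N. (\<Sum>j<N. P i j * P j k) * x k)"
    by (simp add: app_def sum_distrib_left sum_distrib_right mult.assoc)
       (rule sum.swap)
  also have "\<dots> = app N P x i"
    using assms by (simp add: app_def orth_proj_idem)
  finally show ?thesis .
qed

lemma app_adjoint:
  assumes "orth_proj N P"
  shows "(\<Sum>i<N. app N P x i * y i) = (\<Sum>i<N. x i * app N P y i)"
proof -
  have "(\<Sum>i<N. app N P x i * y i) = (\<Sum>j<N. \<Sum>i<N. P i j * x j * y i)"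
    by (simp add: app_def sum_distrib_right) (rule sum.swap)
  also have "\<dots> = (\<Sum>j<N. x j * app N P y j)"
    unfolding app_def sum_distrib_left
    by (intro sum.cong refl) (simp add: orth_proj_sym[OF assms])
  finally show ?thesis .
qed

text \<open>Moving one factor \<open>P\<close> across the inner product leaves
  \<open>P (P x)\<close>, which is \<open>P x\<close>. This turns \<open><w, a>\<close> into
  \<open><w, w>\<close> for \<open>w = P a\<close>, and \<open><z, P c>\<close> into
  \<open><z, c>\<close> in the perceptron step.\<close>

lemma inner_app_app:
  assumes "orth_proj N P"
  shows "(\<Sum>i<N. app N P x i * app N P y i) = (\<Sum>i<N. app N P x i * y i)"
  using app_adjoint[OF assms, of "app N P x" y] app_app[OF assms] by simp

text \<open>Pythagoras: \<open>0 <= |x - P x|^2 = |x|^2 - |P x|^2\<close>, because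
  \<open><P x, x> = |P x|^2\<close>.\<close>

lemma norm_app_le:
  assumes "orth_proj N P"
  shows "(\<Sum>i<N. (app N P x i)\<^sup>2) \<le> (\<Sum>i<N. (x i)\<^sup>2)"
proof -
  have "0 \<le> (\<Sum>i<N. (x i - app N P x i)\<^sup>2)"
    by (simp add: sum_nonneg)
  also have "\<dots> = (\<Sum>i<N. (x i)\<^sup>2) - 2 * (\<Sum>i<N. app N P x i * x i) + (\<Sum>i<N. (app N P x i)\<^sup>2)"
    by (simp add: power2_diff sum.distrib sum_subtractf sum_distrib_left mult_ac)
  also have "(\<Sum>i<N. app N P x i * x i) = (\<Sum>i<N. (app N P x i)\<^sup>2)"
    using inner_app_app[OF assms, of x x] by (simp add: power2_eq_square)
  finally show ?thesis by simp
qed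

text \<open>Restricts the projection \<open>P\<close> to the orthogonal complement of \<open>a\<close>. When \<open>P a = 0\<close> the
  quotient is \<open>0 / 0 = 0\<close>, so that \<open>P\<close> is left unchanged, as it should be.\<close>

definition deflate :: "nat \<Rightarrow> (nat \<Rightarrow> nat \<Rightarrow> real) \<Rightarrow> (nat \<Rightarrow> real) \<Rightarrow> nat \<Rightarrow> nat \<Rightarrow> real" where
  "deflate N P a i j = P i j - app N P a i * app N P a j / (\<Sum>k<N. app N P a k * app N P a k)"

lemma app_deflate:
  "app N (deflate N P a) x i =
     app N P x i - app N P a i * (\<Sum>j<N. app N P a j * x j) / (\<Sum>k<N. app N P a k * app N P a k)"
  unfolding app_def[of N "deflate N P a"] app_def[of N P x] deflate_def
  by (simp add: left_diff_distrib sum_subtractf sum_distrib_left sum_divide_distrib mult.assoc)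

section \<open>Projecting out the rows one at a time\<close>

lemma sum_squares_0:
  fixes w :: "nat \<Rightarrow> real"
  assumes "(\<Sum>k<N. w k * w k) = 0" "i < N"
  shows "w i = 0"
  using assms by (subst (asm) sum_nonneg_eq_0_iff) auto

text \<open>With \<open>w = P a\<close> one has \<open>P w = w\<close>, so in the square of
  \<open>P - w w^T / q\<close> the two mixed terms and the last term add up to
  \<open>- w w^T / q\<close>. The computation also covers \<open>q = 0\<close>, where every quotient
  is 0.\<close>

lemma orth_proj_deflate:
  assumes P: "orth_proj N P"
  shows "orth_proj N (deflate N P a)"
proof -
  define w where "w = app N P a"
  define q where "q = (\<Sum>k<N. w k * w k)"
  have D: "deflate N P a i j = P i j - w i * w j / q" for i j
    by (simp add: deflate_def w_def q_def)
  have idem: "(\<Sum>k<N. deflate N P a i k * deflate N P a k j) = deflate N P a i j"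
    if ij: "i < N" "j < N" for i j
  proof -
    have wP: "(\<Sum>k<N. P i k * w k) = w i" if "i < N" for i
      using app_app[OF P that, of a] by (simp add: w_def app_def)
    have Pw: "(\<Sum>k<N. w k * P k j) = w j"
      using wP[OF ij(2)] orth_proj_sym[OF P ij(2)] by (simp add: mult.commute)
    have "(\<Sum>k<N. deflate N P a i k * deflate N P a k j) =
        (\<Sum>k<N. P i k * P k j) - (\<Sum>k<N. P i k * w k) * (w j / q)
        - w i / q * (\<Sum>k<N. w k * P k j) + (w i / q) * (\<Sum>k<N. w k * w k) * (w j / q)"
      unfolding D sum_distrib_left sum_distrib_right sum_subtractf[symmetric] sum.distrib[symmetric]
      by (intro sum.cong refl) (simp add: algebra_simps)
    also have "\<dots> = P i j - w i * w j / q"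
      using P ij by (simp add: wP Pw orth_proj_idem q_def[symmetric])
    finally show ?thesis by (simp add: D)
  qed
  show ?thesis
    unfolding orth_proj_def
  proof (intro conjI allI impI)
    show "deflate N P a i j = deflate N P a j i" if "i < N" "j < N" for i j
      using orth_proj_sym[OF P that] by (simp add: D)
  qed (use idem in auto)
qed

text \<open>The orthogonal projection onto the complement of the span of \<open>a 0\<close>, ...,
  \<open>a (r - 1)\<close>: Gram-Schmidt in projector form, without keeping the orthogonal
  basis.\<close>

fun row_proj :: "nat \<Rightarrow> (nat \<Rightarrow> nat \<Rightarrow> real) \<Rightarrow> nat \<Rightarrow> nat \<Rightarrow> nat \<Rightarrow> real" where
  "row_proj N a 0 = (\<lambda>i j. if i = j then 1 else 0)"
| "row_proj N a (Suc r) = deflate N (row_proj N a r) (a r)"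

lemma orth_proj_row_proj: "orth_proj N (row_proj N a r)"
proof (induction r)
  case 0
  have "(\<Sum>k<N. (if i = k then 1 else 0) * (if k = j then 1 else 0)) = (if i = j then 1 else 0 :: real)"
    if "i < N" for i j
    using that by (subst sum.cong[OF refl, of _ _ "\<lambda>k. if i = k then if i = j then 1 else 0 else 0"]) auto
  then show ?case by (simp add: orth_proj_def)
qed (simp add: orth_proj_deflate)

text \<open>For the newest row, \<open><w, a r> = <w, w>\<close> makes the correction cancel
  \<open>w\<close> exactly, and if \<open><w, w> = 0\<close> then \<open>w\<close> is already 0. An
  older row stays annihilated because \<open><P (a r), a q> = <a r, P (a q)> = 0\<close>.\<close>

lemma app_row_proj_row:
  "q < r \<Longrightarrow> i < N \<Longrightarrow> app N (row_proj N a r) (a q) i = 0"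
proof (induction r arbitrary: i)
  case (Suc r)
  let ?P = "row_proj N a r"
  have P: "orth_proj N ?P" by (rule orth_proj_row_proj)
  show ?case
  proof (cases "q = r")
    case True
    have "(\<Sum>j<N. app N ?P (a r) j * a r j) = (\<Sum>k<N. app N ?P (a r) k * app N ?P (a r) k)"
      using inner_app_app[OF P] by simp
    then show ?thesis
      using True sum_squares_0[of "app N ?P (a r)" N i] Suc.prems(2)
      by (cases "(\<Sum>k<N. app N ?P (a r) k * app N ?P (a r) k) = 0") (simp_all add: app_deflate)
  next
    case False
    with Suc.prems have "q < r" by simp
    then have "(\<Sum>j<N. app N ?P (a r) j * a q j) = 0"
      unfolding app_adjoint[OF P] using Suc.IH by simp
    with \<open>q < r\<close> show ?thesis using Suc.IH Suc.prems(2) by (simp add: app_deflate)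
  qed
qed simp

text \<open>The columns of \<open>I - P\<close> lie in the span of the rows processed so far, with
  coefficients \<open>W\<close>. This converse to annihilating the rows serves twice: it turns a
  vanishing pivot into a linear relation, and it yields \<open>I = P + A^T W\<close> for the
  comparison with \<open>kernel_projection\<close>.\<close>

lemma row_proj_complement:
  "\<exists>W. \<forall>i<N. \<forall>j. (if i = j then 1 else 0) - row_proj N a r i j = (\<Sum>q<r. a q i * W q j)"
proof (induction r)
  case (Suc r)
  let ?P = "row_proj N a r"
  define w where "w = app N ?P (a r)"
  define s where "s = (\<Sum>k<N. w k * w k)"
  obtain W where W: "\<And>i j. i < N \<Longrightarrow> (if i = j then 1 else 0) - ?P i j = (\<Sum>q<r. a q i * W q j)"
    using Suc.IH by auto
  have w: "w i = a r i - (\<Sum>q<r. a q i * app N W (a r) q)" if i: "i < N" for i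
  proof -
    have "w i = (\<Sum>j<N. ((if i = j then 1 else 0) - (\<Sum>q<r. a q i * W q j)) * a r j)"
      using W[OF i] unfolding w_def app_def by (intro sum.cong refl) (auto simp: algebra_simps)
    also have "\<dots> = (\<Sum>j<N. (if i = j then 1 else 0) * a r j) - (\<Sum>j<N. \<Sum>q<r. a q i * W q j * a r j)"
      by (simp add: left_diff_distrib sum_subtractf sum_distrib_right)
    also have "(\<Sum>j<N. (if i = j then 1 else 0) * a r j) = a r i"
      using i by (subst sum.cong[OF refl, of _ _ "\<lambda>j. if i = j then a r j else 0"]) auto
    also have "(\<Sum>j<N. \<Sum>q<r. a q i * W q j * a r j) = (\<Sum>q<r. a q i * app N W (a r) q)"
      by (subst sum.swap) (simp add: app_def sum_distrib_left mult_ac)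
    finally show ?thesis .
  qed
  \<comment> \<open>Deflation adds \<open>w i * w j / s\<close> to \<open>I - P\<close>. Expanding
    the factor \<open>w i\<close> by the identity just proved distributes this term over the rows
    \<open>0\<close>, ..., \<open>r\<close>.\<close>
  define W' where "W' q j = (if q < r then W q j - app N W (a r) q * w j / s else w j / s)" for q j
  have "(if i = j then 1 else 0) - row_proj N a (Suc r) i j = (\<Sum>q<Suc r. a q i * W' q j)"
    if i: "i < N" for i j
  proof -
    have "(\<Sum>q<Suc r. a q i * W' q j)
        = (\<Sum>q<r. a q i * W q j) + (a r i - (\<Sum>q<r. a q i * app N W (a r) q)) * (w j / s)"
    proof -
      have "(\<Sum>q<Suc r. a q i * W' q j)
          = (\<Sum>q<r. a q i * W q j - a q i * app N W (a r) q * (w j / s)) + a r i * (w j / s)"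
        by (simp add: W'_def right_diff_distrib mult.assoc)
      then show ?thesis
        by (simp only: sum_subtractf sum_distrib_right left_diff_distrib)
    qed
    also have "\<dots> = (if i = j then 1 else 0) - ?P i j + w i * w j / s"
      by (simp only: W[OF i, symmetric] w[OF i, symmetric] times_divide_eq_right)
    finally show ?thesis by (simp add: deflate_def w_def s_def)
  qed
  then show ?case by blast
qed simp

text \<open>If \<open>P (a r) = 0\<close>, then \<open>a r = (I - P) (a r)\<close> is a combination
  of the earlier rows, so \<open>v\<close> is a vanishing combination with coefficient 1 at
  \<open>r\<close>. This is what permits the program to divide by the pivot.\<close>

lemma row_proj_nonzero:
  assumes indep: "\<And>v. (\<And>j. j < N \<Longrightarrow> (\<Sum>q<m. v q * a q j) = 0) \<Longrightarrow> \<forall>q<m. v q = 0"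
    and r: "r < m"
  shows "(\<Sum>k<N. app N (row_proj N a r) (a r) k * app N (row_proj N a r) (a r) k) \<noteq> 0"
proof
  let ?P = "row_proj N a r"
  assume "(\<Sum>k<N. app N ?P (a r) k * app N ?P (a r) k) = 0"
  then have w: "app N ?P (a r) i = 0" if "i < N" for i
    using that sum_squares_0[of "app N ?P (a r)" N i] by simp
  obtain W where W: "\<And>i j. i < N \<Longrightarrow> (if i = j then 1 else 0) - ?P i j = (\<Sum>q<r. a q i * W q j)"
    using row_proj_complement[of N a r] by auto
  define v where "v q = (if q < r then - app N W (a r) q else if q = r then 1 else 0)" for q
  have "(\<Sum>q<m. v q * a q i) = 0" if i: "i < N" for i
  proof -
    have "(\<Sum>q<m. v q * a q i) = (\<Sum>q<Suc r. v q * a q i)"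
      using r by (intro sum.mono_neutral_right) (auto simp: v_def)
    then have "(\<Sum>q<m. v q * a q i) = (\<Sum>q<r. v q * a q i) + v r * a r i" by simp
    also have "(\<Sum>q<r. v q * a q i) = - (\<Sum>q<r. a q i * app N W (a r) q)"
      by (simp add: v_def sum_negf mult_ac)
    also have "(\<Sum>q<r. a q i * app N W (a r) q) = (\<Sum>j<N. (\<Sum>q<r. a q i * W q j) * a r j)"
      unfolding app_def sum_distrib_left sum_distrib_right by (subst sum.swap) (simp add: mult_ac)
    also have "\<dots> = (\<Sum>j<N. (if i = j then a r j else 0) - ?P i j * a r j)"
      unfolding W[OF i, symmetric] by (intro sum.cong refl) (auto simp: algebra_simps)
    also have "\<dots> = a r i - app N ?P (a r) i"
      using i by (simp add: sum_subtractf app_def)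
    finally show ?thesis using w[OF i] by (simp add: v_def)
  qed
  from indep[OF this] r have "v r = 0" by blast
  then show False by (simp add: v_def)
qed

section \<open>Comparison with the projection defined by the inverse Gram matrix\<close>

lemma lin_indep_rowsD:
  assumes A: "A \<in> carrier_mat m N" and li: "lin_indep_rows A"
    and v: "v \<in> carrier_vec m" "A\<^sup>T *\<^sub>v v = 0\<^sub>v N"
  shows "v = 0\<^sub>v m"
proof (rule ccontr)
  interpret vec_space "TYPE(real)" N .
  assume "v \<noteq> 0\<^sub>v m"
  then have "lin_dep (set (cols (A\<^sup>T)))"
    using A li v by (intro lin_depI[of "A\<^sup>T" m v]) (auto simp: lin_indep_rows_def)
  with A li show False by (simp add: lin_indep_rows_def)
qed

lemma scalar_prod_lessThan: "v \<bullet> w = (\<Sum>i<dim_vec w. v $ i * w $ i)"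
  by (simp add: scalar_prod_def atLeast0LessThan)

lemma lin_indep_rows_coeffs:
  assumes A: "A \<in> carrier_mat m N" and li: "lin_indep_rows A"
    and v: "\<And>j. j < N \<Longrightarrow> (\<Sum>q<m. v q * A $$ (q, j)) = 0"
  shows "\<forall>q<m. v q = 0"
proof -
  have "A\<^sup>T *\<^sub>v vec m v = 0\<^sub>v N"
    using A v by (intro eq_vecI) (auto simp: scalar_prod_lessThan mult.commute)
  from lin_indep_rowsD[OF A li _ this] have "vec m v = 0\<^sub>v m" by simp
  then have "vec m v $ q = 0" if "q < m" for q using that by simp
  then show ?thesis by simp
qed

text \<open>\<open>A A^T v = 0\<close> gives \<open>|A^T v|^2 = <v, A A^T v> = 0\<close>, hence
  \<open>v = 0\<close> by independence. So the \<open>the\<close> in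
  \<open>kernel_projection\<close> selects a genuine inverse.\<close>

lemma gram_inverse:
  assumes A: "A \<in> carrier_mat m N" and li: "lin_indep_rows A"
  obtains B where "mat_inverse (A * A\<^sup>T) = Some B" "B \<in> carrier_mat m m" "B * (A * A\<^sup>T) = 1\<^sub>m m"
proof -
  have AA: "A * A\<^sup>T \<in> carrier_mat m m" using A by simp
  have "det (A * A\<^sup>T) \<noteq> 0"
  proof
    assume "det (A * A\<^sup>T) = 0"
    then obtain v where v: "v \<in> carrier_vec m" "v \<noteq> 0\<^sub>v m" "A * A\<^sup>T *\<^sub>v v = 0\<^sub>v m"
      using det_0_iff_vec_prod_zero[OF AA] by blast
    define u where "u = A\<^sup>T *\<^sub>v v"
    have u: "u \<in> carrier_vec N" using A v by (simp add: u_def)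
    have "A *\<^sub>v u = 0\<^sub>v m"
      using assoc_mult_mat_vec[OF A _ v(1), of "A\<^sup>T"] A v(3) by (simp add: u_def)
    moreover have "v \<bullet> (A *\<^sub>v u) = u \<bullet> u"
      using transpose_vec_mult_scalar[OF A u v(1)] unfolding u_def[symmetric] by (rule sym)
    ultimately have "(\<Sum>i<N. u $ i * u $ i) = 0" using v u by (simp add: scalar_prod_lessThan)
    then have "u $ i = 0" if "i < N" for i
      using sum_squares_0[of "\<lambda>i. u $ i" N i] that by simp
    with u have "u = 0\<^sub>v N" by (intro eq_vecI) auto
    then have "v = 0\<^sub>v m" unfolding u_def by (rule lin_indep_rowsD[OF A li v(1)])
    with v(2) show False by contradiction
  qed
  from det_non_zero_imp_unit[OF AA this, of "()"] mat_inverse(1)[OF AA, of "()"]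
  obtain B where B: "mat_inverse (A * A\<^sup>T) = Some B" by (cases "mat_inverse (A * A\<^sup>T)") auto
  with mat_inverse(2)[OF AA B] that show ?thesis by blast
qed

text \<open>Let \<open>G\<close> be the left side and \<open>P\<close> the right side.
  \<open>G A^T = 0\<close> by the choice of \<open>B\<close>, and \<open>A P = 0\<close> gives
  \<open>G P = P\<close>. Applying \<open>G\<close> to \<open>I = P + A^T W\<close> then yields
  \<open>G = P\<close>.\<close>

lemma kernel_projection_eq:
  assumes A: "A \<in> carrier_mat m N" and li: "lin_indep_rows A"
  shows "kernel_projection A = mat N N (\<lambda>(i,j). row_proj N (\<lambda>r j. A $$ (r, j)) m i j)"
    (is "_ = ?P")
proof -
  let ?p = "row_proj N (\<lambda>r j. A $$ (r, j)) m"
  obtain B where B: "mat_inverse (A * A\<^sup>T) = Some B" "B \<in> carrier_mat m m" "B * (A * A\<^sup>T) = 1\<^sub>m m"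
    using gram_inverse[OF A li] .
  define G where "G = kernel_projection A"
  have G: "G = 1\<^sub>m N - A\<^sup>T * B * A" using A B by (simp add: G_def kernel_projection_def)
  have Gc: "G \<in> carrier_mat N N" using A B unfolding G by (intro minus_carrier_mat mult_carrier_mat) auto
  have AT: "A\<^sup>T \<in> carrier_mat N m" using A by simp
  have P: "?P \<in> carrier_mat N N" by simp
  obtain W where W: "\<And>i j. i < N \<Longrightarrow> (if i = j then 1 else 0) - ?p i j = (\<Sum>q<m. A $$ (q, i) * W q j)"
    using row_proj_complement[of N "\<lambda>r j. A $$ (r, j)" m] by auto
  define WM where "WM = mat m N (\<lambda>(q,j). W q j)"
  have WM: "WM \<in> carrier_mat m N" by (simp add: WM_def)
  have dec: "1\<^sub>m N = ?P + A\<^sup>T * WM"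
  proof (rule eq_matI)
    fix i j assume "i < dim_row (?P + A\<^sup>T * WM)" "j < dim_col (?P + A\<^sup>T * WM)"
    then have ij: "i < N" "j < N" using A by (auto simp: WM_def)
    then show "1\<^sub>m N $$ (i, j) = (?P + A\<^sup>T * WM) $$ (i, j)"
      using A W[OF ij(1), of j] by (auto simp: WM_def scalar_prod_lessThan algebra_simps)
  qed (use A in \<open>auto simp: WM_def\<close>)
  have AP: "A * ?P = 0\<^sub>m m N"
  proof (rule eq_matI)
    fix q j assume "q < dim_row (0\<^sub>m m N)" "j < dim_col (0\<^sub>m m N)"
    then have qj: "q < m" "j < N" by auto
    then show "(A * ?P) $$ (q, j) = 0\<^sub>m m N $$ (q, j)"
      using A app_row_proj_row[of q m j N "\<lambda>r j. A $$ (r, j)"]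
        orth_proj_sym[OF orth_proj_row_proj[of N "\<lambda>r j. A $$ (r, j)" m] qj(2)]
      by (simp add: scalar_prod_lessThan app_def mult.commute)
  qed (use A in auto)
  have ATB: "A\<^sup>T * B \<in> carrier_mat N m" using AT B by simp
  have ATBA: "A\<^sup>T * B * A \<in> carrier_mat N N" using ATB A by simp
  have "A\<^sup>T * B * A * A\<^sup>T = A\<^sup>T * (B * (A * A\<^sup>T))"
    using assoc_mult_mat[OF ATB A AT] assoc_mult_mat[OF AT B(2), of "A * A\<^sup>T" m] A AT by simp
  also have "\<dots> = A\<^sup>T" using B AT by simp
  finally have GA: "G * A\<^sup>T = 0\<^sub>m N m"
    unfolding G using minus_mult_distrib_mat[OF _ ATBA AT, of "1\<^sub>m N"] AT by simp
  have "A\<^sup>T * B * A * ?P = 0\<^sub>m N N"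
    using assoc_mult_mat[OF ATB A P] right_mult_zero_mat[OF ATB] by (simp add: AP)
  then have GP: "G * ?P = ?P"
    unfolding G using minus_mult_distrib_mat[OF _ ATBA P, of "1\<^sub>m N"] by auto
  have "G = G * (?P + A\<^sup>T * WM)" by (simp only: dec[symmetric] right_mult_one_mat[OF Gc])
  also have "\<dots> = G * ?P + G * (A\<^sup>T * WM)"
    using mult_add_distrib_mat[OF Gc P, of "A\<^sup>T * WM"] AT WM by simp
  also have "G * (A\<^sup>T * WM) = 0\<^sub>m N N"
    using assoc_mult_mat[OF Gc AT WM] WM by (simp add: GA)
  also have "G * ?P + 0\<^sub>m N N = ?P" by (simp add: GP)
  finally show ?thesis by (simp add: G_def)
qed

section \<open>Interior points of the cone\<close>

text \<open>For a block of dimension 1 the index set is empty and the value is 0, so half-lines and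
  second-order cones are treated uniformly from here on.\<close>

definition tail_norm :: "nat list \<Rightarrow> nat \<Rightarrow> (nat \<Rightarrow> real) \<Rightarrow> real" where
  "tail_norm ds i x = L2_set (\<lambda>j. x (offset ds i + Suc j)) {..<ds ! i - 1}"

definition in_interior :: "nat list \<Rightarrow> (nat \<Rightarrow> real) \<Rightarrow> bool" where
  "in_interior ds x \<longleftrightarrow> (\<forall>i<length ds. tail_norm ds i x < x (offset ds i))"

section \<open>Block offsets and sums over blocks\<close>

lemma offset_Suc: "i < length ds \<Longrightarrow> offset ds (Suc i) = offset ds i + ds ! i"
  by (simp add: offset_def take_Suc_conv_app_nth)

lemma offset_0 [simp]: "offset ds 0 = 0"
  by (simp add: offset_def)

lemma offset_length [simp]: "offset ds (length ds) = sum_list ds"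
  by (simp add: offset_def)

lemma offset_mono:
  assumes "i \<le> k" "k \<le> length ds"
  shows "offset ds i \<le> offset ds k"
  using assms by (induction k rule: dec_induct) (auto simp: offset_Suc)

lemma offset_add_le:
  assumes "i < k" "k \<le> length ds"
  shows "offset ds i + ds ! i \<le> offset ds k"
  using offset_mono[of "Suc i" k ds] assms by (simp add: offset_Suc)

lemma offset_add_le_sum_list: "i < length ds \<Longrightarrow> offset ds i + ds ! i \<le> sum_list ds"
  using offset_add_le[of i "length ds" ds] by simp

lemma offset_less:
  assumes "\<forall>d\<in>set ds. d \<ge> 1" "i < length ds"
  shows "offset ds i < sum_list ds"
proof -
  have "ds ! i \<ge> 1" using assms by simp
  then show ?thesis using offset_add_le_sum_list[OF assms(2)] by simp
qed

lemma offset_disjoint: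
  assumes "i < length ds" "k < length ds" "i \<noteq> k" "j < ds ! i"
    "offset ds k \<le> offset ds i + j" "offset ds i + j < offset ds k + ds ! k"
  shows False
  using offset_add_le[of i k ds] offset_add_le[of k i ds] assms by (cases i k rule: linorder_cases) auto

lemma sum_lessThan_add:
  fixes f :: "nat \<Rightarrow> real"
  shows "(\<Sum>j<a + b. f j) = (\<Sum>j<a. f j) + (\<Sum>j<b. f (a + j))"
  by (induction b) simp_all

lemma sum_blocks:
  fixes f :: "nat \<Rightarrow> real"
  shows "(\<Sum>j<sum_list ds. f j) = (\<Sum>i<length ds. \<Sum>j<ds ! i. f (offset ds i + j))"
proof -
  have "(\<Sum>j<offset ds k. f j) = (\<Sum>i<k. \<Sum>j<ds ! i. f (offset ds i + j))" if "k \<le> length ds" for k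
    using that by (induction k) (simp_all add: offset_Suc sum_lessThan_add)
  from this[of "length ds"] show ?thesis by simp
qed

lemma sum_lessThan_split_first:
  fixes f :: "nat \<Rightarrow> real"
  assumes "d \<ge> 1"
  shows "(\<Sum>j<d. f j) = f 0 + (\<Sum>j<d - 1. f (Suc j))"
  using sum.lessThan_Suc_shift[of f "d - 1"] assms by simp

section \<open>The topological interior in coordinates\<close>

lemma vec_norm_L2: "vec_norm v = L2_set (\<lambda>i. v $ i) {..<dim_vec v}"
  by (simp add: vec_norm_def L2_set_def scalar_prod_lessThan power2_eq_square)

lemma block_cone_iff:
  assumes "i < length ds" "ds ! i \<ge> 1"
  shows "block ds i x \<in> block_cone (ds ! i) \<longleftrightarrow> tail_norm ds i (\<lambda>j. x $ j) \<le> x $ offset ds i"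
proof (cases "ds ! i = 1")
  case True
  then show ?thesis by (simp add: block_cone_def half_line_def block_def tail_norm_def)
next
  case False
  have "vec_norm (vec (ds ! i - 1) (\<lambda>j. block ds i x $ Suc j)) = tail_norm ds i (\<lambda>j. x $ j)"
    unfolding vec_norm_L2 tail_norm_def by (rule L2_set_cong) (auto simp: block_def)
  moreover have "block ds i x \<in> carrier_vec (ds ! i)" by (simp add: block_def)
  moreover have "block ds i x $ 0 = x $ offset ds i" using assms by (simp add: block_def)
  ultimately show ?thesis using False by (simp add: block_cone_def second_order_cone_def)
qed

lemma cone_iff:
  assumes "\<forall>d\<in>set ds. d \<ge> 1"
  shows "x \<in> cone ds \<longleftrightarrow> x \<in> carrier_vec (sum_list ds) \<and>
    (\<forall>i<length ds. tail_norm ds i (\<lambda>j. x $ j) \<le> x $ offset ds i)"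
  using assms block_cone_iff unfolding cone_def by auto

lemma abs_diff_le_vec_norm:
  assumes "x \<in> carrier_vec N" "y \<in> carrier_vec N" "i < N"
  shows "\<bar>y $ i - x $ i\<bar> \<le> vec_norm (y - x)"
proof -
  have "norm ((y - x) $ i) \<le> vec_norm (y - x)"
    unfolding vec_norm_L2 using assms member_le_L2_set[of "{..<dim_vec (y - x)}" i "\<lambda>i. \<bar>(y - x) $ i\<bar>"]
    by (simp add: L2_set_def)
  then show ?thesis using assms by simp
qed

lemma tail_norm_diff_le:
  assumes "x \<in> carrier_vec (sum_list ds)" "y \<in> carrier_vec (sum_list ds)" "i < length ds" "ds ! i \<ge> 1"
  shows "tail_norm ds i (\<lambda>j. y $ j) \<le> tail_norm ds i (\<lambda>j. x $ j) + vec_norm (y - x)"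
proof -
  let ?I = "{..<ds ! i - 1}" and ?o = "\<lambda>j. offset ds i + Suc j"
  have le: "?o j < sum_list ds" if "j \<in> ?I" for j
    using offset_add_le_sum_list[OF assms(3)] that assms(4) by auto
  have "tail_norm ds i (\<lambda>j. y $ j) = L2_set (\<lambda>j. x $ ?o j + (y - x) $ ?o j) ?I"
    unfolding tail_norm_def using assms le by (intro L2_set_cong) auto
  also have "\<dots> \<le> tail_norm ds i (\<lambda>j. x $ j) + L2_set (\<lambda>j. (y - x) $ ?o j) ?I"
    unfolding tail_norm_def by (rule L2_set_triangle_ineq)
  also have "L2_set (\<lambda>j. (y - x) $ ?o j) ?I = sqrt (\<Sum>j\<in>?o ` ?I. ((y - x) $ j)\<^sup>2)"
    unfolding L2_set_def by (subst sum.reindex) (auto simp: inj_on_def)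
  also have "\<dots> \<le> vec_norm (y - x)"
    unfolding vec_norm_L2 L2_set_def using assms le by (intro real_sqrt_le_mono sum_mono2) auto
  finally show ?thesis by simp
qed

text \<open>Left to right: lowering the head coordinate of block \<open>i\<close> by
  \<open>\<epsilon> / 2\<close> stays in the cone and does not change the tail, so the gap was
  strict. Right to left: head coordinate and tail norm both move by at most
  \<open>vec_norm (y - x)\<close>.\<close>

lemma interior_cone_iff:
  assumes ds: "\<forall>d\<in>set ds. d \<ge> 1"
  shows "x \<in> vec_interior (sum_list ds) (cone ds) \<longleftrightarrow>
    x \<in> carrier_vec (sum_list ds) \<and> in_interior ds (\<lambda>j. x $ j)"
    (is "?L \<longleftrightarrow> ?R")
proof
  assume ?L
  then obtain \<epsilon> where x: "x \<in> carrier_vec (sum_list ds)" and \<epsilon>: "\<epsilon> > 0"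
    and ball: "\<And>y. y \<in> carrier_vec (sum_list ds) \<Longrightarrow> vec_norm (y - x) < \<epsilon> \<Longrightarrow> y \<in> cone ds"
    by (auto simp: vec_interior_def)
  have "tail_norm ds i (\<lambda>j. x $ j) < x $ offset ds i" if i: "i < length ds" for i
  proof -
    have o: "offset ds i < sum_list ds" by (rule offset_less[OF ds i])
    define y where "y = vec (sum_list ds) (\<lambda>j. if j = offset ds i then x $ j - \<epsilon> / 2 else x $ j)"
    have "vec_norm (y - x) = sqrt (\<Sum>j<sum_list ds. if j = offset ds i then (\<epsilon> / 2)\<^sup>2 else 0)"
      unfolding vec_norm_L2 L2_set_def using x
      by (intro arg_cong[of _ _ sqrt] sum.cong) (auto simp: y_def power2_eq_square)
    also have "\<dots> < \<epsilon>" using o \<epsilon> by simp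
    finally have "y \<in> cone ds" by (intro ball) (auto simp: y_def)
    then have "tail_norm ds i (\<lambda>j. y $ j) \<le> y $ offset ds i"
      using i by (simp add: cone_iff[OF ds])
    moreover have "tail_norm ds i (\<lambda>j. y $ j) = tail_norm ds i (\<lambda>j. x $ j)"
      unfolding tail_norm_def using offset_add_le_sum_list[OF i]
      by (intro L2_set_cong) (auto simp: y_def)
    ultimately show ?thesis using o \<epsilon> by (simp add: y_def)
  qed
  with x show ?R by (simp add: in_interior_def)
next
  assume R: ?R
  define g where "g i = x $ offset ds i - tail_norm ds i (\<lambda>j. x $ j)" for i
  \<comment> \<open>Half of the smallest gap, since head and tail may each use up
    \<open>\<epsilon>\<close>. The inserted 1 keeps the minimum meaningful when there are no
    blocks.\<close>
  define \<epsilon> where "\<epsilon> = Min (insert 1 (g ` {..<length ds})) / 2"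
  have g: "g i > 0" if "i < length ds" for i using R that by (simp add: g_def in_interior_def)
  have \<epsilon>: "\<epsilon> > 0" using g by (auto simp: \<epsilon>_def)
  have le: "2 * \<epsilon> \<le> g i" if "i < length ds" for i
    using that by (auto simp: \<epsilon>_def intro!: Min_le)
  have "y \<in> cone ds" if y: "y \<in> carrier_vec (sum_list ds)" "vec_norm (y - x) < \<epsilon>" for y
    unfolding cone_iff[OF ds]
  proof (intro conjI allI impI)
    fix i assume i: "i < length ds"
    then have d: "ds ! i \<ge> 1" using ds by simp
    then have "offset ds i < sum_list ds" using offset_add_le_sum_list[OF i] by simp
    then show "tail_norm ds i (\<lambda>j. y $ j) \<le> y $ offset ds i"
      using abs_diff_le_vec_norm[of x "sum_list ds" y "offset ds i"] tail_norm_diff_le[of x ds y i]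
        R y i d le[OF i] by (auto simp: g_def)
  qed (use y in auto)
  with \<epsilon> R show ?L by (auto simp: vec_interior_def)
qed

lemma dim_cone_unit [simp]: "dim_vec (cone_unit ds) = sum_list ds"
  by (induction ds) (simp_all add: cone_unit_def)

lemma cone_unit_sum:
  assumes "\<forall>d\<in>set ds. d \<ge> 1"
  shows "(\<Sum>j<sum_list ds. cone_unit ds $ j * f j) = (\<Sum>i<length ds. f (offset ds i))"
  using assms
proof (induction ds arbitrary: f)
  case (Cons d ds)
  have cu: "cone_unit (d # ds) = unit_vec d 0 @\<^sub>v cone_unit ds" by (simp add: cone_unit_def)
  have "(\<Sum>j<sum_list (d # ds). cone_unit (d # ds) $ j * f j) =
      (\<Sum>j<d. unit_vec d 0 $ j * f j) + (\<Sum>j<sum_list ds. cone_unit ds $ j * f (d + j))"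
    by (simp add: cu sum_lessThan_add)
  also have "(\<Sum>j<d. unit_vec d 0 $ j * f j) = f 0"
    using Cons.prems by (simp add: sum_lessThan_split_first)
  also have "(\<Sum>j<sum_list ds. cone_unit ds $ j * f (d + j)) = (\<Sum>i<length ds. f (d + offset ds i))"
    using Cons.IH[of "\<lambda>j. f (d + j)"] Cons.prems by simp
  also have "f 0 + (\<Sum>i<length ds. f (d + offset ds i)) = (\<Sum>i<length (d # ds). f (offset (d # ds) i))"
    by (simp add: offset_def sum.lessThan_Suc_shift del: sum.lessThan_Suc)
  finally show ?case .
qed (simp add: cone_unit_def)

lemma cone_unit_scalar_prod:
  assumes "\<forall>d\<in>set ds. d \<ge> 1" "y \<in> carrier_vec (sum_list ds)"
  shows "cone_unit ds \<bullet> y = (\<Sum>i<length ds. y $ offset ds i)"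
  using cone_unit_sum[OF assms(1), of "\<lambda>j. y $ j"] assms(2) by (simp add: scalar_prod_lessThan)

lemma tail_norm_nonneg: "0 \<le> tail_norm ds k z"
  by (simp add: tail_norm_def)

text \<open>In each block the tail contributes at most the square of the head, and the Euclidean
  norm of the nonnegative heads is at most their sum. For heads of total 1 this is the starting
  bound \<open>|z|^2 <= |y|^2 <= 2\<close>.\<close>

lemma sum_squares_interior_le:
  assumes ds: "\<forall>d\<in>set ds. d \<ge> 1" and y: "in_interior ds y"
  shows "(\<Sum>j<sum_list ds. (y j)\<^sup>2) \<le> 2 * (\<Sum>i<length ds. y (offset ds i))\<^sup>2"
proof -
  have pos: "0 \<le> y (offset ds i)" if "i < length ds" for i
    using y that by (auto simp: in_interior_def tail_norm_def intro: order_trans[OF L2_set_nonneg less_imp_le])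
  have "(\<Sum>j<sum_list ds. (y j)\<^sup>2) = (\<Sum>i<length ds. (y (offset ds i))\<^sup>2 + (tail_norm ds i y)\<^sup>2)"
    unfolding sum_blocks using ds
    by (intro sum.cong refl) (simp add: sum_lessThan_split_first tail_norm_def L2_set_def sum_nonneg)
  also have "\<dots> \<le> (\<Sum>i<length ds. 2 * (y (offset ds i))\<^sup>2)"
    using y power_mono[OF less_imp_le tail_norm_nonneg]
    by (intro sum_mono) (simp add: in_interior_def)
  also have "\<dots> = 2 * (L2_set (\<lambda>i. y (offset ds i)) {..<length ds})\<^sup>2"
    by (simp add: L2_set_def sum_nonneg sum_distrib_left)
  also have "\<dots> \<le> 2 * (\<Sum>i<length ds. y (offset ds i))\<^sup>2"
    using pos by (intro mult_left_mono power_mono L2_set_le_sum L2_set_nonneg) auto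
  finally show ?thesis .
qed

section \<open>The perceptron step\<close>

definition embed :: "nat list \<Rightarrow> nat \<Rightarrow> (nat \<Rightarrow> real) \<Rightarrow> nat \<Rightarrow> real" where
  "embed ds k c j = (if offset ds k \<le> j \<and> j < offset ds k + ds ! k then c (j - offset ds k) else 0)"

lemma embed_offset: "j < ds ! k \<Longrightarrow> embed ds k c (offset ds k + j) = c j"
  by (simp add: embed_def)

lemma embed_other:
  "i < length ds \<Longrightarrow> k < length ds \<Longrightarrow> i \<noteq> k \<Longrightarrow> j < ds ! i \<Longrightarrow> embed ds k c (offset ds i + j) = 0"
  using offset_disjoint[of i ds k j] by (auto simp: embed_def)

text \<open>\<open>f j 0 = 0\<close> removes all other blocks. Used with \<open>f\<close> a product
  with \<open>z\<close>, a square and a product with an entry of \<open>P\<close>; in the last case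
  it shows that only the columns of block \<open>k\<close> matter.\<close>

lemma sum_embed:
  assumes "k < length ds" and 0: "\<And>j. f j 0 = (0::real)"
  shows "(\<Sum>j<sum_list ds. f j (embed ds k c j)) = (\<Sum>l<ds ! k. f (offset ds k + l) (c l))"
proof -
  have "(\<Sum>j<sum_list ds. f j (embed ds k c j)) =
      (\<Sum>i<length ds. if i = k then \<Sum>l<ds ! k. f (offset ds k + l) (c l) else 0)"
    unfolding sum_blocks using assms
    by (intro sum.cong refl) (auto simp: embed_offset embed_other)
  then show ?thesis using assms(1) by simp
qed

text \<open>The boundary point \<open>(1; - z\<^sub>1 / \<parallel>z\<^sub>1\<parallel>)\<close> of the \<open>k\<close>-th cone; for \<open>z\<^sub>1 = 0\<close> the denominator 1
  makes it \<open>(1; 0)\<close>.\<close>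

definition separating_direction :: "nat list \<Rightarrow> nat \<Rightarrow> (nat \<Rightarrow> real) \<Rightarrow> nat \<Rightarrow> real" where
  "separating_direction ds k z j = (if j = 0 then 1
     else - z (offset ds k + j) / (if tail_norm ds k z \<le> 0 then 1 else tail_norm ds k z))"

lemma tail_norm_square: "(tail_norm ds k z)\<^sup>2 = (\<Sum>j<ds ! k - 1. (z (offset ds k + Suc j))\<^sup>2)"
  by (simp add: tail_norm_def L2_set_def sum_nonneg)

text \<open>The norm is 1 if the tail of \<open>z\<close> is nonzero and 0 otherwise; an inequality
  covers both, and the half-line as well.\<close>

lemma separating_direction_tail:
  "L2_set (\<lambda>j. separating_direction ds k z (Suc j)) {..<ds ! k - 1} \<le> 1"
proof -
  let ?t = "tail_norm ds k z"
  let ?den = "if ?t \<le> 0 then 1 else ?t"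
  have "L2_set (\<lambda>j. separating_direction ds k z (Suc j)) {..<ds ! k - 1} = sqrt (?t\<^sup>2 / ?den\<^sup>2)"
    unfolding L2_set_def tail_norm_square
    by (simp add: separating_direction_def power_divide sum_divide_distrib)
  also have "\<dots> \<le> 1" using tail_norm_nonneg[of ds k z] by auto
  finally show ?thesis .
qed

lemma separating_direction_norm:
  assumes "ds ! k \<ge> 1"
  shows "(\<Sum>l<ds ! k. (separating_direction ds k z l)\<^sup>2) \<le> 2"
proof -
  have "sqrt (\<Sum>j<ds ! k - 1. (separating_direction ds k z (Suc j))\<^sup>2) \<le> 1"
    using separating_direction_tail by (simp add: L2_set_def)
  then have "(\<Sum>j<ds ! k - 1. (separating_direction ds k z (Suc j))\<^sup>2) \<le> 1" by simp
  then show ?thesis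
    using assms by (simp add: sum_lessThan_split_first) (simp add: separating_direction_def)
qed

text \<open>The sum equals \<open>z0 - t\<close> for tail norm \<open>t > 0\<close>. For
  \<open>t = 0\<close> it is \<open>z0\<close> itself, which the hypothesis makes
  nonpositive.\<close>

lemma separating_direction_inner:
  assumes "ds ! k \<ge> 1" "z (offset ds k) \<le> tail_norm ds k z"
  shows "(\<Sum>l<ds ! k. z (offset ds k + l) * separating_direction ds k z l) \<le> 0"
proof -
  let ?t = "tail_norm ds k z"
  let ?den = "if ?t \<le> 0 then 1 else ?t"
  have "(\<Sum>l<ds ! k. z (offset ds k + l) * separating_direction ds k z l) = z (offset ds k) - ?t\<^sup>2 / ?den"
    unfolding sum_lessThan_split_first[OF assms(1)] tail_norm_square
    by (simp add: separating_direction_def power2_eq_square sum_divide_distrib sum_negf)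
  also have "\<dots> \<le> 0"
    using assms(2) tail_norm_nonneg[of ds k z] by (auto simp: power2_eq_square)
  finally show ?thesis .
qed

text \<open>In block \<open>k\<close> the triangle inequality adds a tail of norm at most 1 against
  an increase of the head by exactly 1, so the strict gap of \<open>y\<close> survives; the other
  blocks do not change.\<close>

lemma in_interior_add_direction:
  assumes k: "k < length ds" and y: "in_interior ds y" and d: "\<forall>d\<in>set ds. d \<ge> 1"
  shows "in_interior ds (\<lambda>j. y j + embed ds k (separating_direction ds k z) j)"
  unfolding in_interior_def
proof (intro allI impI)
  fix i assume i: "i < length ds"
  let ?c = "separating_direction ds k z"
  let ?y = "\<lambda>j. y j + embed ds k ?c j"
  have di: "ds ! i \<ge> 1" using d i by simp
  show "tail_norm ds i ?y < ?y (offset ds i)"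
  proof (cases "i = k")
    case True
    have "tail_norm ds k ?y = L2_set (\<lambda>j. y (offset ds k + Suc j) + ?c (Suc j)) {..<ds ! k - 1}"
      unfolding tail_norm_def by (intro L2_set_cong refl) (simp add: embed_def)
    also have "\<dots> \<le> tail_norm ds k y + L2_set (\<lambda>j. ?c (Suc j)) {..<ds ! k - 1}"
      unfolding tail_norm_def by (rule L2_set_triangle_ineq)
    also have "\<dots> < y (offset ds k) + 1"
      using separating_direction_tail[of ds k z] y k by (auto simp: in_interior_def intro: add_less_le_mono)
    finally show ?thesis
      using True di embed_offset[of 0 ds k ?c] by (simp add: separating_direction_def)
  next
    case False
    have e: "embed ds k ?c (offset ds i + j) = 0" if "j < ds ! i" for j
      using embed_other[OF i k False that] .
    have "tail_norm ds i ?y = tail_norm ds i y"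
      unfolding tail_norm_def using e[of "Suc _"] by (intro L2_set_cong refl) (simp add: less_diff_conv)
    then show ?thesis using e[of 0] di y i by (simp add: in_interior_def)
  qed
qed

lemma sum_offsets_add_direction:
  assumes k: "k < length ds" and d: "\<forall>d\<in>set ds. d \<ge> 1"
  shows "(\<Sum>i<length ds. y (offset ds i) + embed ds k (separating_direction ds k z) (offset ds i)) =
    (\<Sum>i<length ds. y (offset ds i)) + 1"
proof -
  let ?c = "separating_direction ds k z"
  have "embed ds k ?c (offset ds i) = (if i = k then 1 else 0)" if "i < length ds" for i
    using embed_other[of i ds k 0 ?c] embed_offset[of 0 ds k ?c] that k d
    by (auto simp: separating_direction_def Suc_le_eq)
  then show ?thesis using k by (simp add: sum.distrib)
qed

lemma perceptron_norm_step:
  assumes P: "orth_proj N P" and z: "\<And>i. i < N \<Longrightarrow> z i = app N P y i"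
    and zc: "(\<Sum>i<N. z i * c i) \<le> 0" and c: "(\<Sum>i<N. (c i)\<^sup>2) \<le> 2"
  shows "(\<Sum>i<N. (z i + app N P c i)\<^sup>2) \<le> (\<Sum>i<N. (z i)\<^sup>2) + 2"
proof -
  have "(\<Sum>i<N. z i * app N P c i) = (\<Sum>i<N. z i * c i)"
    using inner_app_app[OF P, of y c] z by simp
  moreover have "(\<Sum>i<N. (z i + app N P c i)\<^sup>2) =
      (\<Sum>i<N. (z i)\<^sup>2) + 2 * (\<Sum>i<N. z i * app N P c i) + (\<Sum>i<N. (app N P c i)\<^sup>2)"
    by (simp add: power2_sum sum.distrib sum_distrib_left mult.assoc)
  ultimately show ?thesis using zc c norm_app_le[OF P, of c] by linarith
qed

definition perceptron_inv :: "nat list \<Rightarrow> (nat \<Rightarrow> nat \<Rightarrow> real) \<Rightarrow> nat \<Rightarrow> (nat \<Rightarrow> real) \<Rightarrow> (nat \<Rightarrow> real) \<Rightarrow> bool" where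
  "perceptron_inv ds P t y z \<longleftrightarrow> in_interior ds y \<and> (\<Sum>i<length ds. y (offset ds i)) = real t + 1 \<and>
     (\<forall>i<sum_list ds. z i = app (sum_list ds) P y i) \<and> (\<Sum>i<sum_list ds. (z i)\<^sup>2) \<le> 2 * (real t + 1)"

lemma perceptron_inv_init:
  assumes ds: "\<forall>d\<in>set ds. d \<ge> 1" and P: "orth_proj (sum_list ds) P"
    and y: "in_interior ds y" "(\<Sum>i<length ds. y (offset ds i)) = 1"
    and z: "\<And>i. i < sum_list ds \<Longrightarrow> z i = app (sum_list ds) P y i"
  shows "perceptron_inv ds P 0 y z"
proof -
  have "(\<Sum>i<sum_list ds. (z i)\<^sup>2) = (\<Sum>i<sum_list ds. (app (sum_list ds) P y i)\<^sup>2)"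
    using z by simp
  also have "\<dots> \<le> 2"
    using norm_app_le[OF P, of y] sum_squares_interior_le[OF ds y(1)] y(2) by simp
  finally show ?thesis using y z by (simp add: perceptron_inv_def)
qed

text \<open>The hypotheses on \<open>y'\<close> and \<open>z'\<close> are written as the program
  computes them. \<open>app_C\<close> identifies the partial column sum with \<open>P\<close>
  applied to the embedded direction, so that \<open>z'\<close> is again \<open>P y'\<close>.\<close>

lemma perceptron_inv_step:
  assumes ds: "\<forall>d\<in>set ds. d \<ge> 1" and P: "orth_proj (sum_list ds) P"
    and inv: "perceptron_inv ds P t y z" and k: "k < length ds"
    and out: "z (offset ds k) \<le> tail_norm ds k z"
    and y': "\<And>j. y' j = y j + embed ds k (separating_direction ds k z) j"
    and z': "\<And>i. i < sum_list ds \<Longrightarrow>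
      z' i = z i + (\<Sum>l<ds ! k. P i (offset ds k + l) * separating_direction ds k z l)"
  shows "perceptron_inv ds P (Suc t) y' z'"
proof -
  let ?N = "sum_list ds" and ?c = "separating_direction ds k z"
  let ?C = "embed ds k ?c"
  have y'_eq: "y' = (\<lambda>j. y j + ?C j)" using y' by auto
  have d: "ds ! k \<ge> 1" using ds k by simp
  have app_C: "app ?N P ?C i = (\<Sum>l<ds ! k. P i (offset ds k + l) * ?c l)" for i
    unfolding app_def using sum_embed[OF k, of "\<lambda>j x. P i j * x" ?c] by simp
  have z: "z i = app ?N P y i" if "i < ?N" for i
    using inv that by (simp add: perceptron_inv_def)
  have "(\<Sum>i<?N. z i * ?C i) \<le> 0"
    using sum_embed[OF k, of "\<lambda>j x. z j * x" ?c] separating_direction_inner[of ds k z, OF d out] by simp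
  moreover have "(\<Sum>i<?N. (?C i)\<^sup>2) \<le> 2"
    using sum_embed[OF k, of "\<lambda>j x. x\<^sup>2" ?c] separating_direction_norm[of ds k z, OF d] by simp
  ultimately have "(\<Sum>i<?N. (z i + app ?N P ?C i)\<^sup>2) \<le> (\<Sum>i<?N. (z i)\<^sup>2) + 2"
    using perceptron_norm_step[OF P z] by blast
  also have "(\<Sum>i<?N. (z i)\<^sup>2) \<le> 2 * (real t + 1)" using inv unfolding perceptron_inv_def by blast
  also have "(\<Sum>i<?N. (z i + app ?N P ?C i)\<^sup>2) = (\<Sum>i<?N. (z' i)\<^sup>2)"
    using z' by (simp add: app_C)
  finally have "(\<Sum>i<?N. (z' i)\<^sup>2) \<le> 2 * (real (Suc t) + 1)" by simp
  moreover have "z' i = app ?N P y' i" if "i < ?N" for i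
    using z[OF that] z'[OF that] by (simp add: y'_eq app_add app_C)
  moreover have "in_interior ds y'"
    unfolding y'_eq using inv by (intro in_interior_add_direction[OF k _ ds]) (simp add: perceptron_inv_def)
  moreover have "(\<Sum>i<length ds. y' (offset ds i)) = real (Suc t) + 1"
    unfolding y'_eq sum_offsets_add_direction[OF k ds] using inv by (simp add: perceptron_inv_def)
  ultimately show ?thesis by (simp add: perceptron_inv_def)
qed

lemma in_interior_cong:
  assumes "\<forall>d\<in>set ds. d \<ge> 1" "\<And>j. j < sum_list ds \<Longrightarrow> x j = y j"
  shows "in_interior ds x \<longleftrightarrow> in_interior ds y"
proof -
  have "x (offset ds i + j) = y (offset ds i + j)" if "i < length ds" "j < ds ! i" for i j
    using assms(2) offset_add_le_sum_list[OF that(1)] that(2) by simp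
  moreover from this[of _ 0] have "x (offset ds i) = y (offset ds i)" if "i < length ds" for i
    using assms(1) that by (simp add: Suc_le_eq)
  moreover have "tail_norm ds i x = tail_norm ds i y" if "i < length ds" for i
    unfolding tail_norm_def using that calculation(1)[of i "Suc _"] by (intro L2_set_cong refl) (simp add: less_diff_conv)
  ultimately show ?thesis by (simp add: in_interior_def)
qed

section \<open>The two outcomes: a cut or a kernel point\<close>

lemma cut_generating_final:
  assumes ds: "\<forall>d\<in>set ds. d \<ge> 1" and A: "A \<in> carrier_mat m (sum_list ds)" "lin_indep_rows A"
    and inv: "perceptron_inv ds (row_proj (sum_list ds) (\<lambda>r j. A $$ (r, j)) m) t y z"
    and t: "t = 8 * length ds ^ 3"
    and k: "k < length ds" "\<And>i. i < length ds \<Longrightarrow> y (offset ds i) \<le> y (offset ds k)"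
    and v: "v = vec (sum_list ds) (\<lambda>j. y j / (real t + 1))"
  shows "cut_generating ds A v k"
proof -
  let ?N = "sum_list ds" and ?n = "length ds" and ?T = "real t + 1"
  let ?P = "row_proj ?N (\<lambda>r j. A $$ (r, j)) m"
  have n: "real ?n > 0" using k by linarith
  have T: "?T > 0" by simp
  have o: "offset ds i < ?N" if "i < ?n" for i using offset_less[OF ds that] .
  have y: "in_interior ds y" "(\<Sum>i<?n. y (offset ds i)) = ?T"
    "\<And>i. i < ?N \<Longrightarrow> z i = app ?N ?P y i" "(\<Sum>i<?N. (z i)\<^sup>2) \<le> 2 * ?T"
    using inv by (auto simp: perceptron_inv_def)
  have "in_interior ds (\<lambda>j. y j / ?T)"
    unfolding in_interior_def
  proof (intro allI impI)
    fix i assume "i < ?n"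
    have "tail_norm ds i (\<lambda>j. y j / ?T) = tail_norm ds i y / ?T"
      unfolding tail_norm_def L2_set_def
      by (simp add: power_divide sum_divide_distrib[symmetric] real_sqrt_divide)
    then show "tail_norm ds i (\<lambda>j. y j / ?T) < y (offset ds i) / ?T"
      using y(1) \<open>i < ?n\<close> T by (simp add: in_interior_def divide_strict_right_mono)
  qed
  then have int: "v \<in> vec_interior ?N (cone ds)"
    unfolding interior_cone_iff[OF ds] using in_interior_cong[OF ds, of "\<lambda>j. v $ j" "\<lambda>j. y j / ?T"]
    by (simp add: v)
  have unit: "cone_unit ds \<bullet> v = 1"
    using cone_unit_scalar_prod[OF ds, of v] o y(2) T by (simp add: v sum_divide_distrib[symmetric])
  have "vec_norm (kernel_projection A *\<^sub>v v) = sqrt (\<Sum>i<?N. (z i / ?T)\<^sup>2)"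
    unfolding vec_norm_L2 L2_set_def kernel_projection_eq[OF A]
    by (intro arg_cong[of _ _ sqrt] sum.cong)
       (auto simp: v y(3) scalar_prod_lessThan app_def sum_divide_distrib)
  also have "\<dots> = sqrt (\<Sum>i<?N. (z i)\<^sup>2) / ?T"
    by (simp add: power_divide sum_divide_distrib[symmetric] real_sqrt_divide)
  also have "\<dots> \<le> sqrt (2 * ?T) / ?T"
    using y(4) by (intro divide_right_mono real_sqrt_le_mono) auto
  finally have norm: "2 * sqrt (real ?n) * vec_norm (kernel_projection A *\<^sub>v v) \<le>
      2 * sqrt (real ?n) * (sqrt (2 * ?T) / ?T)"
    by (intro mult_left_mono) auto
  have "2 * sqrt (real ?n) * sqrt (2 * ?T) = sqrt (8 * real ?n * ?T)"
  proof -
    have "8 * real ?n * ?T = 4 * (real ?n * (2 * ?T))" by simp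
    then show ?thesis by (simp only: real_sqrt_mult real_sqrt_four mult.assoc)
  qed
  \<comment> \<open>The iteration count enters here: after squaring and cancelling \<open>T\<close>,
    the claim is \<open>8 * n^3 <= T\<close>, and \<open>T\<close> is
    \<open>8 * n^3 + 1\<close>.\<close>
  also have "\<dots> \<le> ?T / real ?n"
  proof (rule real_le_lsqrt)
    have "8 * real ?n ^ 3 \<le> ?T" by (simp add: t)
    then have "8 * real ?n ^ 3 * ?T \<le> ?T * ?T" by (intro mult_right_mono) auto
    then show "8 * real ?n * ?T \<le> (?T / real ?n)\<^sup>2"
      using n by (simp add: field_simps power2_eq_square power3_eq_cube)
  qed (use n in auto)
  \<comment> \<open>The largest head is at least the average of all \<open>n\<close> heads, whose
    sum is \<open>T\<close>.\<close>
  also have "\<dots> \<le> y (offset ds k)"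
  proof -
    have "?T \<le> (\<Sum>i<?n. y (offset ds k))" unfolding y(2)[symmetric] by (intro sum_mono k) auto
    then show ?thesis using n by (simp add: field_simps)
  qed
  finally have "2 * sqrt (real ?n) * (sqrt (2 * ?T) / ?T) \<le> y (offset ds k) / ?T"
    using divide_right_mono[of "2 * sqrt (real ?n) * sqrt (2 * ?T)" "y (offset ds k)" ?T] T by simp
  with norm have "2 * sqrt (real ?n) * vec_norm (kernel_projection A *\<^sub>v v) \<le> v $ offset ds k"
    using o[OF k(1)] by (simp add: v)
  with int unit k show ?thesis by (simp add: cut_generating_def)
qed

text \<open>For a row \<open>a_q\<close> of \<open>A\<close>,
  \<open><P y, a_q> = <y, P a_q> = 0\<close>. Nothing is asked of \<open>y\<close>: only that
  \<open>z\<close> lies in the range of \<open>P\<close>.\<close>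

lemma kernel_final:
  assumes ds: "\<forall>d\<in>set ds. d \<ge> 1" and A: "A \<in> carrier_mat m (sum_list ds)"
    and z: "in_interior ds z"
      "\<And>i. i < sum_list ds \<Longrightarrow> z i = app (sum_list ds) (row_proj (sum_list ds) (\<lambda>r j. A $$ (r, j)) m) y i"
    and v: "v = vec (sum_list ds) z"
  shows "v \<in> vec_interior (sum_list ds) (cone ds) \<and> A *\<^sub>v v = 0\<^sub>v m"
proof
  let ?N = "sum_list ds"
  let ?P = "row_proj ?N (\<lambda>r j. A $$ (r, j)) m"
  show "v \<in> vec_interior ?N (cone ds)"
    unfolding interior_cone_iff[OF ds] using z(1) in_interior_cong[OF ds, of "\<lambda>j. v $ j" z]
    by (simp add: v)
  show "A *\<^sub>v v = 0\<^sub>v m"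
  proof (rule eq_vecI)
    fix q assume "q < dim_vec (0\<^sub>v m)"
    then have q: "q < m" by simp
    then have "(A *\<^sub>v v) $ q = (\<Sum>j<?N. app ?N ?P y j * A $$ (q, j))"
      using A z(2) by (simp add: scalar_prod_lessThan v mult.commute)
    also have "\<dots> = (\<Sum>j<?N. y j * app ?N ?P (\<lambda>j. A $$ (q, j)) j)"
      by (rule app_adjoint[OF orth_proj_row_proj])
    also have "\<dots> = 0" using app_row_proj_row[OF q, of _ ?N "\<lambda>r j. A $$ (r, j)"] by simp
    finally show "(A *\<^sub>v v) $ q = 0\<^sub>v m $ q" using q by simp
  qed (use A in simp)
qed

section \<open>Weakest preconditions with cost\<close>

text \<open>Requiring an execution to exist makes this total correctness: termination and
  definedness of every division and square root are part of the claim. The postcondition also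
  receives the operation count.\<close>

definition wp :: "com \<Rightarrow> (nat \<Rightarrow> store \<Rightarrow> bool) \<Rightarrow> store \<Rightarrow> bool" where
  "wp c Q s \<longleftrightarrow> (\<exists>t s'. exec c s t s' \<and> Q t s')"

lemma wpI: "exec c s t s' \<Longrightarrow> Q t s' \<Longrightarrow> wp c Q s"
  by (auto simp: wp_def)

lemma wp_Skip [simp]: "wp Skip Q s \<longleftrightarrow> Q 0 s"
  by (auto simp: wp_def intro: exec.Skip elim: SkipE)

lemma wp_NAssign [simp]: "wp (NAssign a i p) Q s \<longleftrightarrow> Q 0 (nwrite a (nval s i) (nval s p) s)"
  by (auto simp: wp_def intro: exec.NAssign elim: NAssignE)

lemma wp_RAssign [simp]:
  "wp (RAssign a i p) Q s \<longleftrightarrow> rdefined s p \<and> Q (rops p) (rwrite a (nval s i) (rval s p) s)"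
  by (auto simp: wp_def intro: exec.RAssign elim: RAssignE)

lemma wp_Compare [simp]:
  "wp (Compare a i p q) Q s \<longleftrightarrow> rdefined s p \<and> rdefined s q \<and>
     Q (rops p + rops q + 1) (nwrite a (nval s i) (if rval s p \<le> rval s q then 1 else 0) s)"
  unfolding wp_def by (auto elim!: CompareE intro!: exI exec.Compare)

lemma wp_Seq: "wp (Seq c c') Q s \<longleftrightarrow> wp c (\<lambda>t. wp c' (\<lambda>t'. Q (t + t'))) s"
  unfolding wp_def by (blast elim: SeqE intro: exec.Seq)

lemma wp_If: "wp (If b c c') Q s \<longleftrightarrow> (if bval s b then wp c Q s else wp c' Q s)"
  unfolding wp_def by (auto elim: IfE intro: exec.IfTrue exec.IfFalse)

section \<open>Frame conditions\<close>

fun mods :: "com \<Rightarrow> string set" where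
  "mods Skip = {}"
| "mods (NAssign a i p) = {a}"
| "mods (RAssign a i p) = {a}"
| "mods (Compare a i p q) = {a}"
| "mods (Seq c c') = mods c \<union> mods c'"
| "mods (If b c c') = mods c \<union> mods c'"
| "mods (While b c) = mods c"

text \<open>One set of names governs both memories: writing to a natural or a real array of some
  name releases both arrays of that name.\<close>

definition frame :: "string set \<Rightarrow> store \<Rightarrow> store \<Rightarrow> bool" where
  "frame X s s' \<longleftrightarrow> (\<forall>a. a \<notin> X \<longrightarrow> nats s' a = nats s a \<and> reals s' a = reals s a)"

lemma frame_nats: "frame X s s' \<Longrightarrow> a \<notin> X \<Longrightarrow> nats s' a = nats s a"
  by (simp add: frame_def)

lemma frame_refl [simp]: "frame X s s"
  by (simp add: frame_def)

lemma frame_trans: "frame X s s' \<Longrightarrow> frame X s' s'' \<Longrightarrow> frame X s s''"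
  by (simp add: frame_def)

lemma frame_mono: "frame X s s' \<Longrightarrow> X \<subseteq> Y \<Longrightarrow> frame Y s s'"
  by (auto simp: frame_def)

lemma nats_nwrite [simp]: "nats (nwrite a i v s) = (nats s)(a := (nats s a)(i := v))"
  by (simp add: nwrite_def)

lemma reals_nwrite [simp]: "reals (nwrite a i v s) = reals s"
  by (simp add: nwrite_def)

lemma nats_rwrite [simp]: "nats (rwrite a i v s) = nats s"
  by (simp add: rwrite_def)

lemma reals_rwrite [simp]: "reals (rwrite a i v s) = (reals s)(a := (reals s a)(i := v))"
  by (simp add: rwrite_def)

lemma frame_nwrite: "frame X s s' \<Longrightarrow> a \<in> X \<Longrightarrow> frame X s (nwrite a i v s')"
  by (auto simp: frame_def)

lemma frame_exec: "exec c s t s' \<Longrightarrow> frame (mods c) s s'"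
proof (induction rule: exec.induct)
  case (Seq c s t s' c' t' s'')
  then show ?case
    by (metis frame_mono frame_trans mods.simps(5) sup_ge1 sup_ge2)
next
  case (WhileTrue s b c t s' t' s'')
  then show ?case by (metis frame_trans mods.simps(7))
qed (auto simp: frame_def)

lemma wp_frame: "wp c Q s \<Longrightarrow> wp c (\<lambda>t s'. Q t s' \<and> frame (mods c) s s') s"
  by (auto simp: wp_def dest: frame_exec)

lemma wpE:
  assumes "wp c Q s"
  obtains t s' where "exec c s t s'" "Q t s'" "frame (mods c) s s'"
  using assms frame_exec by (auto simp: wp_def)

section \<open>Counted loops and their proof rules\<close>

text \<open>The counter lives in the natural memory, so loop control is free of charge. The bound
  \<open>p\<close> is evaluated again before every iteration, which is why the rules below ask that
  it stay constant.\<close>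

definition For :: "string \<Rightarrow> nexp \<Rightarrow> com \<Rightarrow> com" where
  "For v p c = Seq (NAssign v (NNum 0) (NNum 0))
     (While (BLess (NCell v (NNum 0)) p)
       (Seq c (NAssign v (NNum 0) (NAdd (NCell v (NNum 0)) (NNum 1)))))"

lemma mods_For [simp]: "mods (For v p c) = insert v (mods c)"
  by (auto simp: For_def)

text \<open>The invariant takes the iteration number as an argument and must not read the loop counter from
  the store (\<open>counter\<close>); the counter is only available to the body.\<close>

lemma wp_For:
  assumes bound: "\<And>s'. frame (insert v (mods c)) s s' \<Longrightarrow> nval s' p = n"
    and v: "v \<notin> mods c"
    and counter: "\<And>i x s'. I i (nwrite v 0 x s') = I i s'"
    and init: "I 0 s"
    and body: "\<And>i s'. i < n \<Longrightarrow> frame (insert v (mods c)) s s' \<Longrightarrow> nats s' v 0 = i \<Longrightarrow> I i s' \<Longrightarrow>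
      wp c (\<lambda>t s''. t \<le> B \<and> I (Suc i) s'') s'"
    and post: "\<And>t s'. t \<le> n * B \<Longrightarrow> frame (insert v (mods c)) s s' \<Longrightarrow> I n s' \<Longrightarrow> Q t s'"
  shows "wp (For v p c) Q s"
proof -
  let ?X = "insert v (mods c)"
  let ?w = "While (BLess (NCell v (NNum 0)) p)
       (Seq c (NAssign v (NNum 0) (NAdd (NCell v (NNum 0)) (NNum 1))))"
  \<comment> \<open>Induction on the number \<open>k\<close> of iterations still to be run, for all
    counter values and stores; the cost bound \<open>k * B\<close> then accumulates along the
    induction.\<close>
  have loop: "\<exists>t s''. exec ?w s' t s'' \<and> t \<le> k * B \<and> frame ?X s s'' \<and> I n s''"
    if "i + k = n" "frame ?X s s'" "nats s' v 0 = i" "I i s'" for i k s'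
    using that
  proof (induction k arbitrary: i s')
    case 0
    then have "exec ?w s' 0 s'" using bound by (intro exec.WhileFalse) auto
    with 0 show ?case by auto
  next
    case (Suc k)
    then have "i < n" by simp
    from wp_frame[OF body[OF this Suc.prems(2,3,4)]]
    obtain t s1 where s1: "exec c s' t s1" "t \<le> B" "I (Suc i) s1" "frame (mods c) s' s1"
      by (auto simp: wp_def)
    let ?s2 = "nwrite v 0 (Suc i) s1"
    have "nats s1 v 0 = i" using s1(4) v Suc.prems(3) by (simp add: frame_def)
    then have e: "exec (Seq c (NAssign v (NNum 0) (NAdd (NCell v (NNum 0)) (NNum 1)))) s' (t + 0) ?s2"
      using s1(1) exec.NAssign[of v "NNum 0" "NAdd (NCell v (NNum 0)) (NNum 1)" s1]
      by (intro exec.Seq[of _ _ _ s1]) auto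
    have f: "frame ?X s ?s2"
      using frame_trans[OF Suc.prems(2) frame_mono[OF s1(4)]] by (auto intro: frame_nwrite)
    obtain t' s'' where w: "exec ?w ?s2 t' s''" "t' \<le> k * B" "frame ?X s s''" "I n s''"
      using Suc.IH[OF _ f] Suc.prems(1) s1(3) counter by auto
    have "bval s' (BLess (NCell v (NNum 0)) p)" using bound[OF Suc.prems(2)] Suc.prems by simp
    from exec.WhileTrue[OF this e w(1)] show ?case using w s1(2) by (intro exI conjI) auto
  qed
  have "frame ?X s (nwrite v 0 0 s)" by (auto intro: frame_nwrite)
  from loop[OF add_0 this] init counter
  obtain t s'' where "exec ?w (nwrite v 0 0 s) t s''" "t \<le> n * B" "frame ?X s s''" "I n s''" by auto
  moreover from exec.Seq[OF exec.NAssign[of v "NNum 0" "NNum 0" s]] this(1)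
  have "exec (For v p c) s (0 + t) s''" by (auto simp: For_def)
  ultimately show ?thesis using post by (intro wpI) auto
qed

definition Accumulate :: "string \<Rightarrow> nexp \<Rightarrow> string \<Rightarrow> nexp \<Rightarrow> rexp \<Rightarrow> com" where
  "Accumulate v p a k e = For v p (RAssign a k (RAdd (RCell a k) e))"

lemma mods_Accumulate [simp]: "mods (Accumulate v p a k e) = {v, a}"
  by (simp add: Accumulate_def)

lemma wp_Accumulate:
  assumes "v \<noteq> a"
    and bound: "\<And>s'. frame {v, a} s s' \<Longrightarrow> nval s' p = n"
    and idx: "\<And>s'. frame {v, a} s s' \<Longrightarrow> nval s' k = l"
    and summand: "\<And>i s'. i < n \<Longrightarrow> frame {v, a} s s' \<Longrightarrow> nats s' v 0 = i \<Longrightarrow> rdefined s' e \<and> rval s' e = f i"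
    and post: "\<And>t s'. t \<le> n * (rops e + 1) \<Longrightarrow> frame {v, a} s s' \<Longrightarrow>
      reals s' a = (reals s a)(l := reals s a l + (\<Sum>i<n. f i)) \<Longrightarrow> Q t s'"
  shows "wp (Accumulate v p a k e) Q s"
  unfolding Accumulate_def
proof (rule wp_For[where n = n and B = "rops e + 1" and
    I = "\<lambda>i s'. reals s' a = (reals s a)(l := reals s a l + (\<Sum>j<i. f j))"])
  fix i s' assume "i < n" and fr: "frame (insert v (mods (RAssign a k (RAdd (RCell a k) e)))) s s'"
    and "nats s' v 0 = i" and I: "reals s' a = (reals s a)(l := reals s a l + (\<Sum>j<i. f j))"
  moreover from fr have "nval s' k = l" using idx by simp
  ultimately show "wp (RAssign a k (RAdd (RCell a k) e)) (\<lambda>t s''. t \<le> rops e + 1 \<and>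
      reals s'' a = (reals s a)(l := reals s a l + (\<Sum>j<Suc i. f j))) s'"
    using summand[of i s'] by (simp add: add.assoc)
qed (use assms in auto)

text \<open>Injectivity of \<open>g\<close> guarantees that cell \<open>g i\<close> still holds its
  original value when iteration \<open>i\<close> arrives. The expression may therefore read the very
  cell that it overwrites, as the in-place updates of \<open>P\<close> and \<open>y\<close>
  do.\<close>

lemma wp_array_update:
  assumes "v \<noteq> a"
    and bound: "\<And>s'. frame {v, a} s s' \<Longrightarrow> nval s' p = n"
    and inj: "inj_on g {..<n}"
    and elem: "\<And>i s'. i < n \<Longrightarrow> frame {v, a} s s' \<Longrightarrow> nats s' v 0 = i \<Longrightarrow>
      reals s' a (g i) = reals s a (g i) \<Longrightarrow> nval s' k = g i \<and> rdefined s' e \<and> rval s' e = f i"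
    and post: "\<And>t s'. t \<le> n * rops e \<Longrightarrow> frame {v, a} s s' \<Longrightarrow> (\<And>i. i < n \<Longrightarrow> reals s' a (g i) = f i) \<Longrightarrow>
      (\<And>x. x \<notin> g ` {..<n} \<Longrightarrow> reals s' a x = reals s a x) \<Longrightarrow> Q t s'"
  shows "wp (For v p (RAssign a k e)) Q s"
proof (rule wp_For[where n = n and B = "rops e" and
    I = "\<lambda>i s'. (\<forall>j<i. reals s' a (g j) = f j) \<and> (\<forall>x. x \<notin> g ` {..<i} \<longrightarrow> reals s' a x = reals s a x)"])
  fix i s' assume i: "i < n" and "frame (insert v (mods (RAssign a k e))) s s'" "nats s' v 0 = i"
    and I: "(\<forall>j<i. reals s' a (g j) = f j) \<and> (\<forall>x. x \<notin> g ` {..<i} \<longrightarrow> reals s' a x = reals s a x)"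
  moreover have new: "g i \<noteq> g j" if "j < i" for j
    using inj_onD[OF inj, of i j] that i by auto
  then have "g i \<notin> g ` {..<i}" by auto
  ultimately have e: "nval s' k = g i \<and> rdefined s' e \<and> rval s' e = f i"
    using elem[of i s'] by simp
  show "wp (RAssign a k e) (\<lambda>t s''. t \<le> rops e \<and> (\<forall>j<Suc i. reals s'' a (g j) = f j) \<and>
      (\<forall>x. x \<notin> g ` {..<Suc i} \<longrightarrow> reals s'' a x = reals s a x)) s'"
    using I e new new[THEN not_sym] by (auto simp: less_Suc_eq lessThan_Suc)
qed (use assms in auto)

abbreviation nv :: "string \<Rightarrow> nexp" where "nv a \<equiv> NCell a (NNum 0)"
abbreviation rv :: "string \<Rightarrow> rexp" where "rv a \<equiv> RCell a (NNum 0)"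

text \<open>Adds to \<open>z\<close> rather than overwriting it, and takes the number of columns as
  a parameter. The same code thus forms full products from a zero vector and performs the
  incremental update with the columns of one block.\<close>

definition MatVec :: "string \<Rightarrow> nexp \<Rightarrow> rexp \<Rightarrow> com" where
  "MatVec z p e = For ''i'' (nv ''N'') (Accumulate ''j'' p z (nv ''i'') e)"

lemma mods_MatVec [simp]: "mods (MatVec z p e) = {''i'', ''j'', z}"
  by (simp add: MatVec_def)

lemma wp_MatVec:
  assumes z: "z \<notin> {''i'', ''j'', ''N''}" and N: "nats s ''N'' 0 = N"
    and bound: "\<And>s'. frame {''i'', ''j'', z} s s' \<Longrightarrow> nval s' p = l"
    and elem: "\<And>i j s'. i < N \<Longrightarrow> j < l \<Longrightarrow> frame {''i'', ''j'', z} s s' \<Longrightarrow> nats s' ''i'' 0 = i \<Longrightarrow>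
      nats s' ''j'' 0 = j \<Longrightarrow> rdefined s' e \<and> rval s' e = f i j"
    and post: "\<And>t s'. t \<le> N * (l * (rops e + 1)) \<Longrightarrow> frame {''i'', ''j'', z} s s' \<Longrightarrow>
      (\<And>i. i < N \<Longrightarrow> reals s' z i = reals s z i + (\<Sum>j<l. f i j)) \<Longrightarrow> Q t s'"
  shows "wp (MatVec z p e) Q s"
  unfolding MatVec_def
proof (rule wp_For[where n = N and B = "l * (rops e + 1)" and
    I = "\<lambda>i s'. \<forall>b. reals s' z b = reals s z b + (if b < i then \<Sum>j<l. f b j else 0)"])
  fix i s' assume i: "i < N" and fr: "frame (insert ''i'' (mods (Accumulate ''j'' p z (nv ''i'') e))) s s'"
    and c: "nats s' ''i'' 0 = i"
    and I: "\<forall>b. reals s' z b = reals s z b + (if b < i then \<Sum>j<l. f b j else 0)"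
  have fr': "frame {''i'', ''j'', z} s s''" if "frame {''j'', z} s' s''" for s''
    using frame_trans[of "{''i'', ''j'', z}" s s' s''] frame_mono[OF that, of "{''i'', ''j'', z}"] fr by auto
  have c': "nats s'' ''i'' 0 = i" if "frame {''j'', z} s' s''" for s''
    using that c z by (auto simp: frame_def)
  show "wp (Accumulate ''j'' p z (nv ''i'') e) (\<lambda>t s''. t \<le> l * (rops e + 1) \<and>
      (\<forall>b. reals s'' z b = reals s z b + (if b < Suc i then \<Sum>j<l. f b j else 0))) s'"
  proof (rule wp_Accumulate[where n = l and l = i and f = "f i"])
    show "rdefined s'' e \<and> rval s'' e = f i j"
      if "j < l" "frame {''j'', z} s' s''" "nats s'' ''j'' 0 = j" for j s''
      using elem[OF i that(1) fr'[OF that(2)] c'[OF that(2)] that(3)] .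
    show "nval s'' p = l" if "frame {''j'', z} s' s''" for s''
      using bound[OF fr'[OF that]] .
    show "nval s'' (nv ''i'') = i" if "frame {''j'', z} s' s''" for s''
      using c'[OF that] by simp
    show "t \<le> l * (rops e + 1) \<and>
        (\<forall>b. reals s'' z b = reals s z b + (if b < Suc i then \<Sum>j<l. f b j else 0))"
      if "t \<le> l * (rops e + 1)" "reals s'' z = (reals s' z)(i := reals s' z i + (\<Sum>j<l. f i j))" for t s''
      using that I by (simp add: less_Suc_eq)
  qed (use z in auto)
next
  show "nval s' (nv ''N'') = N" if "frame (insert ''i'' (mods (Accumulate ''j'' p z (nv ''i'') e))) s s'" for s'
    using frame_nats[OF that, of "''N''"] z N by auto
next
  show "Q t s'" if "t \<le> N * (l * (rops e + 1))"
    "frame (insert ''i'' (mods (Accumulate ''j'' p z (nv ''i'') e))) s s'"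
    "\<forall>b. reals s' z b = reals s z b + (if b < N then \<Sum>j<l. f b j else 0)" for t s'
    using that by (intro post) auto
qed (use z in auto)

section \<open>The program\<close>

abbreviation entry :: "string \<Rightarrow> string \<Rightarrow> nexp" where
  "entry a b \<equiv> NAdd (NMul (nv a) (nv ''N'')) (nv b)"

definition Offsets :: com where
  "Offsets = For ''i'' (nv ''n'')
     (Seq (NAssign ''o'' (nv ''i'') (nv ''N''))
       (NAssign ''N'' (NNum 0) (NAdd (nv ''N'') (NCell ''d'' (nv ''i'')))))"

text \<open>Relies on the array \<open>P\<close> being 0 initially; literals are free, so nothing is
  counted.\<close>

definition Identity :: com where
  "Identity = For ''i'' (nv ''N'') (RAssign ''P'' (entry ''i'' ''i'') (RNum 1))"

definition Deflate :: com where
  "Deflate =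
     Seq (For ''i'' (nv ''N'') (RAssign ''w'' (nv ''i'') (RNum 0)))
    (Seq (MatVec ''w'' (nv ''N'') (RMul (RCell ''P'' (entry ''i'' ''j'')) (RCell ''A'' (entry ''r'' ''j''))))
    (Seq (RAssign ''q'' (NNum 0) (RNum 0))
    (Seq (Accumulate ''i'' (nv ''N'') ''q'' (NNum 0) (RMul (RCell ''w'' (nv ''i'')) (RCell ''w'' (nv ''i''))))
    (For ''i'' (nv ''N'') (For ''j'' (nv ''N'')
      (RAssign ''P'' (entry ''i'' ''j'') (RSub (RCell ''P'' (entry ''i'' ''j''))
        (RDiv (RMul (RCell ''w'' (nv ''i'')) (RCell ''w'' (nv ''j''))) (rv ''q'')))))))))"

definition Projection :: com where
  "Projection = Seq Identity (For ''r'' (nv ''m'') Deflate)"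

definition InitZ :: com where
  "InitZ = MatVec ''Z'' (nv ''N'') (RMul (RCell ''P'' (entry ''i'' ''j'')) (RCell ''y'' (nv ''j'')))"

text \<open>The value \<open>n\<close> in \<open>k\<close> signals that no block violates the strict
  inequality. All blocks are scanned and the last violating one is kept, together with its tail norm
  in \<open>den\<close>, which \<open>Update\<close> uses as denominator.\<close>

definition Find :: com where
  "Find = Seq (NAssign ''k'' (NNum 0) (nv ''n''))
     (For ''i'' (nv ''n'')
       (Seq (RAssign ''acc'' (NNum 0) (RNum 0))
       (Seq (Accumulate ''j'' (NSub (NCell ''d'' (nv ''i'')) (NNum 1)) ''acc'' (NNum 0)
              (RMul (RCell ''Z'' (NAdd (NCell ''o'' (nv ''i'')) (NAdd (nv ''j'') (NNum 1))))
                    (RCell ''Z'' (NAdd (NCell ''o'' (nv ''i'')) (NAdd (nv ''j'') (NNum 1))))))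
       (Seq (Compare ''f'' (NNum 0) (RCell ''Z'' (NCell ''o'' (nv ''i''))) (RSqrt (rv ''acc'')))
            (If (BLess (NNum 0) (nv ''f''))
              (Seq (NAssign ''k'' (NNum 0) (nv ''i'')) (RAssign ''den'' (NNum 0) (RSqrt (rv ''acc''))))
              Skip)))))"

text \<open>The loop fills all of \<open>c\<close>, including cell 0, which is then overwritten by
  the head coordinate 1. A tail norm of 0 in \<open>den\<close> is first replaced by 1, so that the
  division is defined.\<close>

definition Update :: com where
  "Update =
     Seq (Compare ''f'' (NNum 0) (rv ''den'') (RNum 0))
    (Seq (If (BLess (NNum 0) (nv ''f'')) (RAssign ''den'' (NNum 0) (RNum 1)) Skip)
    (Seq (For ''j'' (NCell ''d'' (nv ''k''))
           (RAssign ''c'' (nv ''j'')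
             (RDiv (RSub (RNum 0) (RCell ''Z'' (NAdd (NCell ''o'' (nv ''k'')) (nv ''j'')))) (rv ''den''))))
    (Seq (RAssign ''c'' (NNum 0) (RNum 1))
    (Seq (For ''j'' (NCell ''d'' (nv ''k''))
           (RAssign ''y'' (NAdd (NCell ''o'' (nv ''k'')) (nv ''j''))
             (RAdd (RCell ''y'' (NAdd (NCell ''o'' (nv ''k'')) (nv ''j''))) (RCell ''c'' (nv ''j'')))))
         (MatVec ''Z'' (NCell ''d'' (nv ''k''))
           (RMul (RCell ''P'' (NAdd (NMul (nv ''i'') (nv ''N'')) (NAdd (NCell ''o'' (nv ''k'')) (nv ''j''))))
                 (RCell ''c'' (nv ''j''))))))))"

text \<open>The main loop has no early exit; once \<open>case\<close> is 2, the remaining iterations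
  do nothing and cost nothing.\<close>

definition Step :: com where
  "Step = If (BLess (nv ''case'') (NNum 1))
     (Seq Find (If (BLess (nv ''k'') (nv ''n'')) Update (NAssign ''case'' (NNum 0) (NNum 2)))) Skip"

text \<open>The natural iteration count cannot be converted to a real number, so the normalising
  factor \<open>T + 1\<close> is recovered in \<open>q\<close> as the sum of the head coordinates of
  \<open>y\<close>.\<close>

definition Finish :: com where
  "Finish = If (BLess (nv ''case'') (NNum 1))
     (Seq (NAssign ''case'' (NNum 0) (NNum 1))
     (Seq (NAssign ''k'' (NNum 0) (NNum 0))
     (Seq (For ''i'' (nv ''n'')
            (Seq (Compare ''f'' (NNum 0) (RCell ''y'' (NCell ''o'' (nv ''k''))) (RCell ''y'' (NCell ''o'' (nv ''i''))))
                 (If (BLess (NNum 0) (nv ''f'')) (NAssign ''k'' (NNum 0) (nv ''i'')) Skip)))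
     (Seq (RAssign ''q'' (NNum 0) (RNum 0))
     (Seq (Accumulate ''i'' (nv ''n'') ''q'' (NNum 0) (RCell ''y'' (NCell ''o'' (nv ''i''))))
          (For ''j'' (nv ''N'') (RAssign ''out'' (nv ''j'') (RDiv (RCell ''y'' (nv ''j'')) (rv ''q'')))))))))
     (For ''j'' (nv ''N'') (RAssign ''out'' (nv ''j'') (RCell ''Z'' (nv ''j''))))"

definition Basic_Procedure :: com where
  "Basic_Procedure =
     Seq Offsets (Seq Projection (Seq InitZ
    (Seq (For ''t'' (NMul (NNum 8) (NMul (nv ''n'') (NMul (nv ''n'') (nv ''n'')))) Step) Finish)))"

definition layout :: "nat list \<Rightarrow> store \<Rightarrow> bool" where
  "layout ds s \<longleftrightarrow> nats s ''n'' 0 = length ds \<and> nats s ''N'' 0 = sum_list ds \<and>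
     (\<forall>i<length ds. nats s ''d'' i = ds ! i \<and> nats s ''o'' i = offset ds i)"

definition holds_matrix :: "nat \<Rightarrow> (nat \<Rightarrow> nat \<Rightarrow> real) \<Rightarrow> store \<Rightarrow> bool" where
  "holds_matrix N P s \<longleftrightarrow> (\<forall>i<N. \<forall>j<N. reals s ''P'' (i * N + j) = P i j)"

section \<open>Verification of the linear algebra routines\<close>

lemma entry_inject:
  fixes N :: nat
  assumes "b < N" "j < N"
  shows "a * N + b = i * N + j \<longleftrightarrow> a = i \<and> b = j"
proof
  assume e: "a * N + b = i * N + j"
  then have "(a * N + b) div N = (i * N + j) div N" "(a * N + b) mod N = (i * N + j) mod N" by simp_all
  then show "a = i \<and> b = j" using assms by simp
qed simp

lemma wp_Offsets:
  assumes "nats s ''n'' 0 = length ds" "nats s ''N'' 0 = 0" "\<And>i. i < length ds \<Longrightarrow> nats s ''d'' i = ds ! i"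
  shows "wp Offsets (\<lambda>t s'. t = 0 \<and> layout ds s') s"
  unfolding Offsets_def
proof (rule wp_For[where n = "length ds" and B = 0 and
    I = "\<lambda>i s'. nats s' ''N'' 0 = offset ds i \<and> (\<forall>b<i. nats s' ''o'' b = offset ds b)"])
  fix i s' assume "i < length ds" "nats s' ''i'' 0 = i"
    "frame (insert ''i'' (mods (Seq (NAssign ''o'' (nv ''i'') (nv ''N''))
       (NAssign ''N'' (NNum 0) (NAdd (nv ''N'') (NCell ''d'' (nv ''i'')))))))  s s'"
    "nats s' ''N'' 0 = offset ds i \<and> (\<forall>b<i. nats s' ''o'' b = offset ds b)"
  then show "wp (Seq (NAssign ''o'' (nv ''i'') (nv ''N''))
       (NAssign ''N'' (NNum 0) (NAdd (nv ''N'') (NCell ''d'' (nv ''i'')))))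
     (\<lambda>t s''. t \<le> 0 \<and> nats s'' ''N'' 0 = offset ds (Suc i) \<and> (\<forall>b<Suc i. nats s'' ''o'' b = offset ds b)) s'"
    using assms by (simp add: wp_Seq frame_def offset_Suc less_Suc_eq)
qed (use assms in \<open>auto simp: frame_def layout_def\<close>)

lemma wp_Identity:
  assumes N: "nats s ''N'' 0 = N" and P: "\<And>x. reals s ''P'' x = 0"
  shows "wp Identity (\<lambda>t s'. t = 0 \<and> holds_matrix N (\<lambda>i j. if i = j then 1 else 0) s') s"
  unfolding Identity_def
proof (rule wp_array_update[where n = N and g = "\<lambda>i. i * N + i" and f = "\<lambda>_. 1"])
  show "inj_on (\<lambda>i. i * N + i) {..<N}"
    by (auto simp: inj_on_def entry_inject)
next
  fix t and s' :: store assume t: "t \<le> N * rops (RNum 1)"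
    and d: "\<And>i. i < N \<Longrightarrow> reals s' ''P'' (i * N + i) = 1"
    and u: "\<And>x. x \<notin> (\<lambda>i. i * N + i) ` {..<N} \<Longrightarrow> reals s' ''P'' x = reals s ''P'' x"
  have "reals s' ''P'' (i * N + j) = (if i = j then 1 else 0)" if ij: "i < N" "j < N" for i j
  proof (cases "i = j")
    case False
    then have "i * N + j \<notin> (\<lambda>i. i * N + i) ` {..<N}" using ij entry_inject[of j N] by auto
    then show ?thesis using False u P by simp
  qed (use d ij in simp)
  then show "t = 0 \<and> holds_matrix N (\<lambda>i j. if i = j then 1 else 0) s'"
    using t by (simp add: holds_matrix_def)
qed (use N in \<open>auto simp: frame_def\<close>)

text \<open>Working in place is sound because the correction reads only \<open>w\<close> and
  \<open>q\<close>, both computed beforehand from the old \<open>P\<close>. In the invariant,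
  exactly the rows before \<open>i\<close> are already corrected.\<close>

lemma wp_rank_one_update:
  assumes N: "nats s ''N'' 0 = N" and P: "holds_matrix N P s" and q: "reals s ''q'' 0 \<noteq> 0"
  shows "wp (For ''i'' (nv ''N'') (For ''j'' (nv ''N'')
      (RAssign ''P'' (entry ''i'' ''j'') (RSub (RCell ''P'' (entry ''i'' ''j''))
        (RDiv (RMul (RCell ''w'' (nv ''i'')) (RCell ''w'' (nv ''j''))) (rv ''q''))))))
    (\<lambda>t s'. t \<le> N * (N * 3) \<and>
       holds_matrix N (\<lambda>i j. P i j - reals s ''w'' i * reals s ''w'' j / reals s ''q'' 0) s') s"
    (is "wp (For _ _ ?row) _ _")
proof (rule wp_For[where n = N and B = "N * 3" and
    I = "\<lambda>i s'. holds_matrix N (\<lambda>a b. P a b - (if a < i then reals s ''w'' a * reals s ''w'' b / reals s ''q'' 0 else 0)) s'"])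
  fix i s' assume i: "i < N" and fr: "frame (insert ''i'' (mods ?row)) s s'" and c: "nats s' ''i'' 0 = i"
    and I: "holds_matrix N (\<lambda>a b. P a b - (if a < i then reals s ''w'' a * reals s ''w'' b / reals s ''q'' 0 else 0)) s'"
  have N': "nats s' ''N'' 0 = N" "reals s' ''w'' = reals s ''w''" "reals s' ''q'' = reals s ''q''"
    using fr N by (auto simp: frame_def)
  show "wp ?row (\<lambda>t s''. t \<le> N * 3 \<and>
      holds_matrix N (\<lambda>a b. P a b - (if a < Suc i then reals s ''w'' a * reals s ''w'' b / reals s ''q'' 0 else 0)) s'') s'"
  proof (rule wp_array_update[where n = N and g = "\<lambda>j. i * N + j" and
        f = "\<lambda>j. P i j - reals s ''w'' i * reals s ''w'' j / reals s ''q'' 0"])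
    fix t and s'' :: store assume t: "t \<le> N * rops (RSub (RCell ''P'' (entry ''i'' ''j''))
        (RDiv (RMul (RCell ''w'' (nv ''i'')) (RCell ''w'' (nv ''j''))) (rv ''q'')))"
      and d: "\<And>j. j < N \<Longrightarrow> reals s'' ''P'' (i * N + j) = P i j - reals s ''w'' i * reals s ''w'' j / reals s ''q'' 0"
      and u: "\<And>x. x \<notin> (\<lambda>j. i * N + j) ` {..<N} \<Longrightarrow> reals s'' ''P'' x = reals s' ''P'' x"
    have "reals s'' ''P'' (a * N + b) =
        P a b - (if a < Suc i then reals s ''w'' a * reals s ''w'' b / reals s ''q'' 0 else 0)"
      if ab: "a < N" "b < N" for a b
    proof (cases "a = i")
      case False
      then have "a * N + b \<notin> (\<lambda>j. i * N + j) ` {..<N}" using ab entry_inject[of b N] by auto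
      then show ?thesis using False u I ab by (simp add: holds_matrix_def less_Suc_eq)
    qed (use d ab in simp)
    then show "t \<le> N * 3 \<and>
        holds_matrix N (\<lambda>a b. P a b - (if a < Suc i then reals s ''w'' a * reals s ''w'' b / reals s ''q'' 0 else 0)) s''"
      using t by (simp add: holds_matrix_def eval_nat_numeral)
  next
    fix j s'' assume "j < N" "frame {''j'', ''P''} s' s''" "nats s'' ''j'' 0 = j"
      "reals s'' ''P'' (i * N + j) = reals s' ''P'' (i * N + j)"
    then show "nval s'' (entry ''i'' ''j'') = i * N + j \<and>
        rdefined s'' (RSub (RCell ''P'' (entry ''i'' ''j''))
        (RDiv (RMul (RCell ''w'' (nv ''i'')) (RCell ''w'' (nv ''j''))) (rv ''q''))) \<and>
        rval s'' (RSub (RCell ''P'' (entry ''i'' ''j''))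
        (RDiv (RMul (RCell ''w'' (nv ''i'')) (RCell ''w'' (nv ''j''))) (rv ''q''))) =
        P i j - reals s ''w'' i * reals s ''w'' j / reals s ''q'' 0"
      using I i c q N' by (simp add: frame_def holds_matrix_def)
  qed (use N' in \<open>auto simp: frame_def inj_on_def\<close>)
qed (use N P in \<open>auto simp: frame_def holds_matrix_def\<close>)

text \<open>The cost is \<open>2 * N^2\<close> for \<open>w = P a\<close>, \<open>2 * N\<close> for
  its square, and \<open>3 * N^2\<close> for a product, a quotient and a difference per entry. The
  function \<open>deflate\<close> tolerates a zero divisor but the machine does not, hence the
  hypothesis \<open>nz\<close>.\<close>

lemma wp_Deflate:
  assumes N: "nats s ''N'' 0 = N" and r: "nats s ''r'' 0 = r" and P: "holds_matrix N P s"
    and a: "\<And>j. j < N \<Longrightarrow> reals s ''A'' (r * N + j) = a j"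
    and nz: "(\<Sum>k<N. app N P a k * app N P a k) \<noteq> 0"
  shows "wp Deflate (\<lambda>t s'. t \<le> 5 * N\<^sup>2 + 2 * N \<and> holds_matrix N (deflate N P a) s') s"
proof -
  let ?w = "app N P a"
  let ?q = "\<Sum>k<N. ?w k * ?w k"
  have "wp (For ''i'' (nv ''N'') (RAssign ''w'' (nv ''i'') (RNum 0)))
      (\<lambda>t s'. t = 0 \<and> (\<forall>i<N. reals s' ''w'' i = 0)) s"
    by (rule wp_array_update[where n = N and g = "\<lambda>i. i" and f = "\<lambda>_. 0"]) (use N in \<open>auto simp: frame_def\<close>)
  then obtain s1 where e1: "exec (For ''i'' (nv ''N'') (RAssign ''w'' (nv ''i'') (RNum 0))) s 0 s1"
    and w1: "\<And>i. i < N \<Longrightarrow> reals s1 ''w'' i = 0" and f1: "frame {''i'', ''w''} s s1"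
    by (rule wpE) auto
  let ?mv = "MatVec ''w'' (nv ''N'') (RMul (RCell ''P'' (entry ''i'' ''j'')) (RCell ''A'' (entry ''r'' ''j'')))"
  have "wp ?mv (\<lambda>t s'. t \<le> N * (N * 2) \<and> (\<forall>i<N. reals s' ''w'' i = ?w i)) s1"
    by (rule wp_MatVec[where N = N and l = N and f = "\<lambda>i j. P i j * a j"])
       (use N r P a f1 w1 in \<open>auto simp: frame_def holds_matrix_def app_def numeral_2_eq_2\<close>)
  then obtain t2 s2 where e2: "exec ?mv s1 t2 s2" and t2: "t2 \<le> N * (N * 2)"
    and w2: "\<And>i. i < N \<Longrightarrow> reals s2 ''w'' i = ?w i" and f2: "frame {''i'', ''j'', ''w''} s1 s2"
    by (rule wpE) auto
  let ?s3 = "rwrite ''q'' 0 0 s2"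
  have e3: "exec (RAssign ''q'' (NNum 0) (RNum 0)) s2 0 ?s3"
    using exec.RAssign[of s2 "RNum 0" "''q''" "NNum 0"] by simp
  let ?acc = "Accumulate ''i'' (nv ''N'') ''q'' (NNum 0) (RMul (RCell ''w'' (nv ''i'')) (RCell ''w'' (nv ''i'')))"
  have "wp ?acc (\<lambda>t s'. t \<le> N * 2 \<and> reals s' ''q'' 0 = ?q) ?s3"
    by (rule wp_Accumulate[where n = N and l = 0 and f = "\<lambda>k. ?w k * ?w k"])
       (use N w2 f1 f2 in \<open>auto simp: frame_def numeral_2_eq_2\<close>)
  then obtain t4 s4 where e4: "exec ?acc ?s3 t4 s4" and t4: "t4 \<le> N * 2"
    and q: "reals s4 ''q'' 0 = ?q" and f4: "frame {''i'', ''q''} ?s3 s4"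
    by (rule wpE) auto
  have s4: "nats s4 ''N'' 0 = N" "holds_matrix N P s4" "reals s4 ''q'' 0 \<noteq> 0" "reals s4 ''w'' = reals s2 ''w''"
    using N P q nz f1 f2 f4 by (auto simp: frame_def holds_matrix_def)
  from wp_rank_one_update[OF s4(1,2,3)]
  obtain t5 s5 where e5: "exec (For ''i'' (nv ''N'') (For ''j'' (nv ''N'')
      (RAssign ''P'' (entry ''i'' ''j'') (RSub (RCell ''P'' (entry ''i'' ''j''))
        (RDiv (RMul (RCell ''w'' (nv ''i'')) (RCell ''w'' (nv ''j''))) (rv ''q'')))))) s4 t5 s5"
    and t5: "t5 \<le> N * (N * 3)"
    and P5: "holds_matrix N (\<lambda>i j. P i j - reals s4 ''w'' i * reals s4 ''w'' j / reals s4 ''q'' 0) s5"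
    by (rule wpE) auto
  have "holds_matrix N (deflate N P a) s5"
    using P5 w2 by (simp add: holds_matrix_def deflate_def q s4(4))
  moreover have "0 + (t2 + (0 + (t4 + t5))) \<le> 5 * N\<^sup>2 + 2 * N"
    using t2 t4 t5 by (simp add: power2_eq_square algebra_simps)
  ultimately show ?thesis
    unfolding Deflate_def by (intro wpI[OF exec.Seq[OF e1 exec.Seq[OF e2 exec.Seq[OF e3 exec.Seq[OF e4 e5]]]]]) simp
qed

section \<open>Correctness of the program\<close>

lemma wp_Projection:
  assumes N: "nats s ''N'' 0 = N" and m: "nats s ''m'' 0 = m" and P: "\<And>x. reals s ''P'' x = 0"
    and a: "\<And>r j. r < m \<Longrightarrow> j < N \<Longrightarrow> reals s ''A'' (r * N + j) = a r j"
    and indep: "\<And>v. (\<And>j. j < N \<Longrightarrow> (\<Sum>q<m. v q * a q j) = 0) \<Longrightarrow> \<forall>q<m. v q = 0"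
  shows "wp Projection (\<lambda>t s'. t \<le> m * (5 * N\<^sup>2 + 2 * N) \<and> holds_matrix N (row_proj N a m) s') s"
proof -
  from wp_Identity[OF N P]
  obtain s1 where e1: "exec Identity s 0 s1" and P1: "holds_matrix N (row_proj N a 0) s1"
    and f1: "frame {''i'', ''P''} s s1"
    by (rule wpE) (auto simp: Identity_def)
  have "wp (For ''r'' (nv ''m'') Deflate)
      (\<lambda>t s'. t \<le> m * (5 * N\<^sup>2 + 2 * N) \<and> holds_matrix N (row_proj N a m) s') s1"
  proof (rule wp_For[where n = m and B = "5 * N\<^sup>2 + 2 * N" and I = "\<lambda>r. holds_matrix N (row_proj N a r)"])
    fix r and s' :: store
    assume r: "r < m" "frame (insert ''r'' (mods Deflate)) s1 s'" "nats s' ''r'' 0 = r"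
      and I: "holds_matrix N (row_proj N a r) s'"
    have s': "nats s' ''N'' 0 = N" "reals s' ''A'' = reals s ''A''"
      using r(2) f1 N by (auto simp: frame_def Deflate_def)
    show "wp Deflate (\<lambda>t s''. t \<le> 5 * N\<^sup>2 + 2 * N \<and> holds_matrix N (row_proj N a (Suc r)) s'') s'"
      unfolding row_proj.simps
      using wp_Deflate[OF s'(1) r(3) I _ row_proj_nonzero[OF indep r(1)]] a r(1) s'(2) by simp
  qed (use m f1 P1 in \<open>auto simp: frame_def Deflate_def holds_matrix_def\<close>)
  then obtain t2 s2 where "exec (For ''r'' (nv ''m'') Deflate) s1 t2 s2"
    "t2 \<le> m * (5 * N\<^sup>2 + 2 * N)" "holds_matrix N (row_proj N a m) s2"
    by (rule wpE) auto
  then show ?thesis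
    unfolding Projection_def by (intro wpI[OF exec.Seq[OF e1]]) auto
qed

lemma wp_InitZ:
  assumes N: "nats s ''N'' 0 = N" and P: "holds_matrix N P s" and Z: "\<And>x. reals s ''Z'' x = 0"
  shows "wp InitZ (\<lambda>t s'. t \<le> N * (N * 2) \<and> (\<forall>i<N. reals s' ''Z'' i = app N P (reals s ''y'') i)) s"
  unfolding InitZ_def
  by (rule wp_MatVec[where N = N and l = N and f = "\<lambda>i j. P i j * reals s ''y'' j"])
     (use N P Z in \<open>auto simp: frame_def holds_matrix_def app_def numeral_2_eq_2\<close>)

text \<open>Each block costs two operations per tail coordinate and at most three more: the
  comparison, its square root, and the square root stored in \<open>den\<close>.\<close>

lemma wp_Find:
  assumes L: "layout ds s" and D: "\<And>i. i < length ds \<Longrightarrow> ds ! i \<le> D"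
  shows "wp Find (\<lambda>t s'. t \<le> length ds * (2 * D + 3) \<and>
      (nats s' ''k'' 0 = length ds \<and> in_interior ds (reals s ''Z'') \<or>
       (nats s' ''k'' 0 < length ds \<and>
        reals s ''Z'' (offset ds (nats s' ''k'' 0)) \<le> tail_norm ds (nats s' ''k'' 0) (reals s ''Z'') \<and>
        reals s' ''den'' 0 = tail_norm ds (nats s' ''k'' 0) (reals s ''Z'')))) s"
proof -
  let ?Z = "reals s ''Z''" and ?n = "length ds"
  let ?s1 = "nwrite ''k'' 0 ?n s"
  have e1: "exec (NAssign ''k'' (NNum 0) (nv ''n'')) s 0 ?s1"
    using exec.NAssign[of "''k''" "NNum 0" "nv ''n''" s] L by (simp add: layout_def)
  let ?acc = "Accumulate ''j'' (NSub (NCell ''d'' (nv ''i'')) (NNum 1)) ''acc'' (NNum 0)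
              (RMul (RCell ''Z'' (NAdd (NCell ''o'' (nv ''i'')) (NAdd (nv ''j'') (NNum 1))))
                    (RCell ''Z'' (NAdd (NCell ''o'' (nv ''i'')) (NAdd (nv ''j'') (NNum 1)))))"
  let ?test = "Seq (Compare ''f'' (NNum 0) (RCell ''Z'' (NCell ''o'' (nv ''i''))) (RSqrt (rv ''acc'')))
            (If (BLess (NNum 0) (nv ''f''))
              (Seq (NAssign ''k'' (NNum 0) (nv ''i'')) (RAssign ''den'' (NNum 0) (RSqrt (rv ''acc''))))
              Skip)"
  let ?body = "Seq (RAssign ''acc'' (NNum 0) (RNum 0)) (Seq ?acc ?test)"
  \<comment> \<open>Either no violation has been met among the blocks before \<open>i\<close>, or
    \<open>k\<close> names one; the second alternative survives both keeping and replacing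
    \<open>k\<close>.\<close>
  let ?I = "\<lambda>i s'. (nats s' ''k'' 0 = ?n \<and> (\<forall>b<i. tail_norm ds b ?Z < ?Z (offset ds b))) \<or>
     (nats s' ''k'' 0 < ?n \<and> ?Z (offset ds (nats s' ''k'' 0)) \<le> tail_norm ds (nats s' ''k'' 0) ?Z \<and>
      reals s' ''den'' 0 = tail_norm ds (nats s' ''k'' 0) ?Z)"
  have "wp (For ''i'' (nv ''n'') ?body) (\<lambda>t s'. t \<le> ?n * (2 * D + 3) \<and> ?I ?n s') ?s1"
  proof (rule wp_For[where n = ?n and B = "2 * D + 3" and I = ?I])
    fix i and s' :: store
    assume i: "i < ?n" and fr: "frame (insert ''i'' (mods ?body)) ?s1 s'"
      and c: "nats s' ''i'' 0 = i" and I: "?I i s'"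
    have s': "layout ds s'" "reals s' ''Z'' = ?Z"
      using L fr by (auto simp: frame_def layout_def)
    let ?s2 = "rwrite ''acc'' 0 0 s'"
    have e2: "exec (RAssign ''acc'' (NNum 0) (RNum 0)) s' 0 ?s2"
      using exec.RAssign[of s' "RNum 0" "''acc''" "NNum 0"] by simp
    have "wp ?acc (\<lambda>t s''. t \<le> (ds ! i - 1) * 2 \<and>
        reals s'' ''acc'' 0 = (\<Sum>j<ds ! i - 1. ?Z (offset ds i + Suc j) * ?Z (offset ds i + Suc j))) ?s2"
      by (rule wp_Accumulate[where n = "ds ! i - 1" and l = 0 and
            f = "\<lambda>j. ?Z (offset ds i + Suc j) * ?Z (offset ds i + Suc j)"])
         (use s' i c in \<open>auto simp: frame_def layout_def numeral_2_eq_2\<close>)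
    then obtain t3 s3 where e3: "exec ?acc ?s2 t3 s3" and t3: "t3 \<le> (ds ! i - 1) * 2"
      and acc: "reals s3 ''acc'' 0 = (\<Sum>j<ds ! i - 1. ?Z (offset ds i + Suc j) * ?Z (offset ds i + Suc j))"
      and f3: "frame {''j'', ''acc''} ?s2 s3"
      by (rule wpE) auto
    have norm: "sqrt (reals s3 ''acc'' 0) = tail_norm ds i ?Z" and pos: "0 \<le> reals s3 ''acc'' 0"
      unfolding acc by (simp_all add: tail_norm_def L2_set_def power2_eq_square sum_nonneg)
    have s3: "reals s3 ''Z'' = ?Z" "nats s3 ''o'' i = offset ds i" "nats s3 ''i'' 0 = i"
      "nats s3 ''k'' = nats s' ''k''" "reals s3 ''den'' = reals s' ''den''"
      using f3 s' i c by (auto simp: frame_def layout_def)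
    have "wp ?test (\<lambda>t s''. t \<le> 3 \<and> ?I (Suc i) s'') s3"
      using I i s3 norm pos by (auto simp: wp_Seq wp_If less_Suc_eq)
    then obtain t4 s4 where e4: "exec ?test s3 t4 s4" and t4: "t4 \<le> 3" and I4: "?I (Suc i) s4"
      by (rule wpE) blast
    have "0 + (t3 + t4) \<le> 2 * D + 3"
      using t3 t4 D[OF i] by linarith
    then show "wp ?body (\<lambda>t s''. t \<le> 2 * D + 3 \<and> ?I (Suc i) s'') s'"
      using I4 by (intro wpI[OF exec.Seq[OF e2 exec.Seq[OF e3 e4]]]) blast
  qed (use L in \<open>auto simp: frame_def layout_def\<close>)
  then obtain t5 s5 where e5: "exec (For ''i'' (nv ''n'') ?body) ?s1 t5 s5" and t5: "t5 \<le> ?n * (2 * D + 3)"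
    and I5: "?I ?n s5"
    by (rule wpE) blast
  show ?thesis
    unfolding Find_def using t5 I5
    by (intro wpI[OF exec.Seq[OF e1 e5]]) (auto simp: in_interior_def)
qed

text \<open>One comparison, then \<open>2 * d\<close> operations for the direction, \<open>d\<close>
  for \<open>y\<close> and \<open>2 * N * d\<close> for \<open>Z\<close>, where \<open>d\<close> is
  the dimension of block \<open>k\<close>.\<close>

lemma wp_Update:
  assumes L: "layout ds s" and P: "holds_matrix (sum_list ds) P s"
    and k: "nats s ''k'' 0 = k" "k < length ds" and d: "ds ! k \<ge> 1" "ds ! k \<le> D"
    and den: "reals s ''den'' 0 = tail_norm ds k (reals s ''Z'')"
  shows "wp Update (\<lambda>t s'. t \<le> 1 + 3 * D + 2 * sum_list ds * D \<and>
      (\<forall>x. reals s' ''y'' x = reals s ''y'' x +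
         embed ds k (separating_direction ds k (reals s ''Z'')) x) \<and>
      (\<forall>i<sum_list ds. reals s' ''Z'' i = reals s ''Z'' i +
         (\<Sum>l<ds ! k. P i (offset ds k + l) * separating_direction ds k (reals s ''Z'') l))) s"
proof -
  let ?Z = "reals s ''Z''" and ?N = "sum_list ds" and ?d = "ds ! k" and ?o = "offset ds k"
  let ?c = "separating_direction ds k ?Z"
  define den' where "den' = (if tail_norm ds k ?Z \<le> 0 then 1 else tail_norm ds k ?Z)"
  have den'_pos: "den' > 0" by (simp add: den'_def)
  let ?guard = "Seq (Compare ''f'' (NNum 0) (rv ''den'') (RNum 0))
    (If (BLess (NNum 0) (nv ''f'')) (RAssign ''den'' (NNum 0) (RNum 1)) Skip)"
  have "wp ?guard (\<lambda>t s'. t = 1 \<and> reals s' ''den'' 0 = den') s"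
    using den by (simp add: wp_Seq wp_If den'_def)
  then obtain t t' s0 s1 where
    e0: "exec (Compare ''f'' (NNum 0) (rv ''den'') (RNum 0)) s t s0"
    and e1: "exec (If (BLess (NNum 0) (nv ''f'')) (RAssign ''den'' (NNum 0) (RNum 1)) Skip) s0 t' s1"
    and t01: "t + t' = 1" and den1: "reals s1 ''den'' 0 = den'" and f1: "frame {''f'', ''den''} s s1"
    by (elim wpE SeqE) (auto simp: insert_commute)
  let ?dir = "For ''j'' (NCell ''d'' (nv ''k'')) (RAssign ''c'' (nv ''j'')
             (RDiv (RSub (RNum 0) (RCell ''Z'' (NAdd (NCell ''o'' (nv ''k'')) (nv ''j'')))) (rv ''den'')))"
  have "wp ?dir (\<lambda>t s'. t \<le> ?d * 2 \<and> (\<forall>j<?d. reals s' ''c'' j = - ?Z (?o + j) / den')) s1"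
    by (rule wp_array_update[where n = ?d and g = "\<lambda>j. j" and f = "\<lambda>j. - ?Z (?o + j) / den'"])
       (use L k f1 den1 den'_pos in \<open>auto simp: frame_def layout_def numeral_2_eq_2\<close>)
  then obtain t2 s2 where e2: "exec ?dir s1 t2 s2" and t2: "t2 \<le> ?d * 2"
    and c2: "\<And>j. j < ?d \<Longrightarrow> reals s2 ''c'' j = - ?Z (?o + j) / den'" and f2: "frame {''j'', ''c''} s1 s2"
    by (rule wpE) auto
  let ?s3 = "rwrite ''c'' 0 1 s2"
  have e3: "exec (RAssign ''c'' (NNum 0) (RNum 1)) s2 0 ?s3"
    using exec.RAssign[of s2 "RNum 1" "''c''" "NNum 0"] by simp
  have c3: "reals ?s3 ''c'' j = ?c j" if "j < ?d" for j
    using c2[OF that] by (simp add: separating_direction_def den'_def)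
  let ?upd = "For ''j'' (NCell ''d'' (nv ''k'')) (RAssign ''y'' (NAdd (NCell ''o'' (nv ''k'')) (nv ''j''))
             (RAdd (RCell ''y'' (NAdd (NCell ''o'' (nv ''k'')) (nv ''j''))) (RCell ''c'' (nv ''j''))))"
  have "wp ?upd (\<lambda>t s'. t \<le> ?d \<and> (\<forall>x. reals s' ''y'' x = reals s ''y'' x + embed ds k ?c x)) ?s3"
  proof (rule wp_array_update[where n = ?d and g = "\<lambda>j. ?o + j" and f = "\<lambda>j. reals s ''y'' (?o + j) + ?c j"])
    fix t4 and s4 :: store
    assume new: "\<And>j. j < ?d \<Longrightarrow> reals s4 ''y'' (?o + j) = reals s ''y'' (?o + j) + ?c j"
      and old: "\<And>x. x \<notin> (\<lambda>j. ?o + j) ` {..<?d} \<Longrightarrow> reals s4 ''y'' x = reals ?s3 ''y'' x"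
      and t4: "t4 \<le> ?d * rops (RAdd (RCell ''y'' (NAdd (NCell ''o'' (nv ''k'')) (nv ''j''))) (RCell ''c'' (nv ''j'')))"
    have "reals s4 ''y'' x = reals s ''y'' x + embed ds k ?c x" for x
    proof (cases "?o \<le> x \<and> x < ?o + ?d")
      case True
      then show ?thesis using new[of "x - ?o"] by (simp add: embed_def less_diff_conv2)
    next
      case False
      then have "x \<notin> (\<lambda>j. ?o + j) ` {..<?d}" by auto
      from old[OF this] False f1 f2 show ?thesis by (auto simp: embed_def frame_def)
    qed
    then show "t4 \<le> ?d \<and> (\<forall>x. reals s4 ''y'' x = reals s ''y'' x + embed ds k ?c x)" using t4 by simp
  next
    fix j and s' :: store
    assume "j < ?d" "frame {''j'', ''y''} ?s3 s'" "nats s' ''j'' 0 = j"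
      "reals s' ''y'' (?o + j) = reals ?s3 ''y'' (?o + j)"
    then show "nval s' (NAdd (NCell ''o'' (nv ''k'')) (nv ''j'')) = ?o + j \<and>
       rdefined s' (RAdd (RCell ''y'' (NAdd (NCell ''o'' (nv ''k'')) (nv ''j''))) (RCell ''c'' (nv ''j''))) \<and>
       rval s' (RAdd (RCell ''y'' (NAdd (NCell ''o'' (nv ''k'')) (nv ''j''))) (RCell ''c'' (nv ''j''))) =
       reals s ''y'' (?o + j) + ?c j"
      using L k f1 f2 c3[of j] by (simp add: frame_def layout_def del: reals_rwrite) simp
  qed (use L k f1 f2 in \<open>auto simp: frame_def layout_def inj_on_def\<close>)
  then obtain t4 s4 where e4: "exec ?upd ?s3 t4 s4" and t4: "t4 \<le> ?d"
    and y4: "\<And>x. reals s4 ''y'' x = reals s ''y'' x + embed ds k ?c x" and f4: "frame {''j'', ''y''} ?s3 s4"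
    by (rule wpE) auto
  have s4: "layout ds s4" "holds_matrix ?N P s4" "nats s4 ''k'' 0 = k" "reals s4 ''Z'' = ?Z"
    "reals s4 ''c'' = reals ?s3 ''c''"
    using L P k f1 f2 f4 by (auto simp: frame_def layout_def holds_matrix_def)
  let ?mv = "MatVec ''Z'' (NCell ''d'' (nv ''k''))
           (RMul (RCell ''P'' (NAdd (NMul (nv ''i'') (nv ''N'')) (NAdd (NCell ''o'' (nv ''k'')) (nv ''j''))))
                 (RCell ''c'' (nv ''j'')))"
  have "wp ?mv (\<lambda>t s'. t \<le> ?N * (?d * 2) \<and>
      (\<forall>i<?N. reals s' ''Z'' i = ?Z i + (\<Sum>l<?d. P i (?o + l) * ?c l))) s4"
  proof (rule wp_MatVec[where N = ?N and l = ?d and f = "\<lambda>i j. P i (?o + j) * ?c j"])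
    fix i j and s' :: store
    assume ij: "i < ?N" "j < ?d" "frame {''i'', ''j'', ''Z''} s4 s'" "nats s' ''i'' 0 = i" "nats s' ''j'' 0 = j"
    have s': "nats s' ''N'' 0 = ?N" "nats s' ''k'' 0 = k" "nats s' ''o'' k = ?o"
      "reals s' ''P'' = reals s4 ''P''" "reals s' ''c'' j = ?c j"
      using s4 ij(2,3) k c3[of j] by (auto simp: frame_def layout_def simp del: reals_rwrite)
    moreover have "?o + j < ?N" using offset_add_le_sum_list[OF k(2)] ij(2) by simp
    then have "reals s4 ''P'' (i * ?N + (?o + j)) = P i (?o + j)"
      using s4(2) ij(1) unfolding holds_matrix_def by blast
    ultimately show "rdefined s' (RMul (RCell ''P'' (NAdd (NMul (nv ''i'') (nv ''N'')) (NAdd (NCell ''o'' (nv ''k'')) (nv ''j''))))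
                 (RCell ''c'' (nv ''j''))) \<and>
        rval s' (RMul (RCell ''P'' (NAdd (NMul (nv ''i'') (nv ''N'')) (NAdd (NCell ''o'' (nv ''k'')) (nv ''j''))))
                 (RCell ''c'' (nv ''j''))) = P i (?o + j) * ?c j"
      using ij by simp
  qed (use s4 k in \<open>auto simp: frame_def layout_def numeral_2_eq_2\<close>)
  then obtain t5 s5 where e5: "exec ?mv s4 t5 s5" and t5: "t5 \<le> ?N * (?d * 2)"
    and Z5: "\<And>i. i < ?N \<Longrightarrow> reals s5 ''Z'' i = ?Z i + (\<Sum>l<?d. P i (?o + l) * ?c l)"
    and f5: "frame {''i'', ''j'', ''Z''} s4 s5"
    by (rule wpE) auto
  have "t5 \<le> ?N * (D * 2)" using t5 d(2) by (meson le_trans mult_le_mono1 mult_le_mono2)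
  then have "t + (t' + (t2 + (0 + (t4 + t5)))) \<le> 1 + 3 * D + 2 * ?N * D"
    using t01 t2 t4 d(2) by simp
  moreover have "reals s5 ''y'' = reals s4 ''y''" using f5 by (simp add: frame_def)
  ultimately show ?thesis
    unfolding Update_def using Z5 y4
    by (intro wpI[OF exec.Seq[OF e0 exec.Seq[OF e1 exec.Seq[OF e2 exec.Seq[OF e3 exec.Seq[OF e4 e5]]]]]]) auto
qed

text \<open>Once a kernel point is found, the norm estimates are dropped. The second alternative
  keeps only that \<open>Z\<close> is interior and in the range of \<open>P\<close>; it does not
  mention \<open>t\<close>, so idle iterations preserve it.\<close>

definition loop_inv :: "nat list \<Rightarrow> (nat \<Rightarrow> nat \<Rightarrow> real) \<Rightarrow> nat \<Rightarrow> store \<Rightarrow> bool" where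
  "loop_inv ds P t s \<longleftrightarrow> layout ds s \<and> holds_matrix (sum_list ds) P s \<and>
     (nats s ''case'' 0 = 0 \<and> perceptron_inv ds P t (reals s ''y'') (reals s ''Z'') \<or>
      nats s ''case'' 0 = 2 \<and> in_interior ds (reals s ''Z'') \<and>
      (\<exists>y. \<forall>i<sum_list ds. reals s ''Z'' i = app (sum_list ds) P y i))"

lemma wp_Step:
  assumes ds: "\<forall>d\<in>set ds. d \<ge> 1" and D: "\<And>i. i < length ds \<Longrightarrow> ds ! i \<le> D"
    and P: "orth_proj (sum_list ds) P" and inv: "loop_inv ds P t s"
  shows "wp Step (\<lambda>u s'. u \<le> length ds * (2 * D + 3) + (1 + 3 * D + 2 * sum_list ds * D) \<and>
    loop_inv ds P (Suc t) s') s"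
proof (cases "nats s ''case'' 0 = 0")
  case False
  with inv show ?thesis by (simp add: Step_def wp_If loop_inv_def)
next
  case True
  have L: "layout ds s" and M: "holds_matrix (sum_list ds) P s"
    and pinv: "perceptron_inv ds P t (reals s ''y'') (reals s ''Z'')"
    using inv True by (auto simp: loop_inv_def)
  obtain u1 s1 where e1: "exec Find s u1 s1" and u1: "u1 \<le> length ds * (2 * D + 3)"
    and res: "nats s1 ''k'' 0 = length ds \<and> in_interior ds (reals s ''Z'') \<or>
       (nats s1 ''k'' 0 < length ds \<and>
        reals s ''Z'' (offset ds (nats s1 ''k'' 0)) \<le> tail_norm ds (nats s1 ''k'' 0) (reals s ''Z'') \<and>
        reals s1 ''den'' 0 = tail_norm ds (nats s1 ''k'' 0) (reals s ''Z''))"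
    and f1: "frame (mods Find) s s1"
    using wp_Find[OF L D] by (rule wpE) auto
  have s1: "layout ds s1" "holds_matrix (sum_list ds) P s1" "reals s1 ''Z'' = reals s ''Z''"
    "reals s1 ''y'' = reals s ''y''" "nats s1 ''case'' = nats s ''case''"
    using f1 L M by (auto simp: Find_def frame_def layout_def holds_matrix_def)
  have n: "nats s1 ''n'' 0 = length ds" using s1(1) by (simp add: layout_def)
  let ?branch = "If (BLess (nv ''k'') (nv ''n'')) Update (NAssign ''case'' (NNum 0) (NNum 2))"
  have "wp ?branch (\<lambda>u s'. u \<le> 1 + 3 * D + 2 * sum_list ds * D \<and> loop_inv ds P (Suc t) s') s1"
  proof (cases "nats s1 ''k'' 0 < length ds")
    case k: True
    let ?k = "nats s1 ''k'' 0"
    have d: "ds ! ?k \<ge> 1" using ds k by simp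
    have den: "reals s1 ''den'' 0 = tail_norm ds ?k (reals s1 ''Z'')"
      and out: "reals s ''Z'' (offset ds ?k) \<le> tail_norm ds ?k (reals s ''Z'')"
      using res k s1(3) by auto
    obtain u2 s2 where e2: "exec Update s1 u2 s2" and u2: "u2 \<le> 1 + 3 * D + 2 * sum_list ds * D"
      and y2: "\<And>x. reals s2 ''y'' x = reals s ''y'' x +
         embed ds ?k (separating_direction ds ?k (reals s ''Z'')) x"
      and Z2: "\<And>i. i < sum_list ds \<Longrightarrow> reals s2 ''Z'' i = reals s ''Z'' i +
         (\<Sum>l<ds ! ?k. P i (offset ds ?k + l) * separating_direction ds ?k (reals s ''Z'') l)"
      and f2: "frame (mods Update) s1 s2"
      using wp_Update[OF s1(1,2) refl k d D[OF k] den] s1(3,4) by (elim wpE) auto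
    have "layout ds s2" "holds_matrix (sum_list ds) P s2" "nats s2 ''case'' 0 = 0"
      using f2 s1 True by (auto simp: Update_def frame_def layout_def holds_matrix_def)
    moreover have "perceptron_inv ds P (Suc t) (reals s2 ''y'') (reals s2 ''Z'')"
      by (rule perceptron_inv_step[where z = "reals s ''Z''", OF ds P pinv k out y2 Z2])
    ultimately have "loop_inv ds P (Suc t) s2" by (simp add: loop_inv_def)
    with e2 u2 k n show ?thesis by (auto simp: wp_If intro: wpI)
  next
    case False
    with res have "in_interior ds (reals s ''Z'')" by simp
    moreover have "\<forall>i<sum_list ds. reals s ''Z'' i = app (sum_list ds) P (reals s ''y'') i"
      using pinv by (simp add: perceptron_inv_def)
    ultimately have "loop_inv ds P (Suc t) (nwrite ''case'' 0 2 s1)"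
      using s1 by (auto simp: loop_inv_def layout_def holds_matrix_def)
    with False n show ?thesis by (simp add: wp_If)
  qed
  then obtain u2 s2 where e2: "exec ?branch s1 u2 s2" and "u2 \<le> 1 + 3 * D + 2 * sum_list ds * D"
    "loop_inv ds P (Suc t) s2" by (rule wpE) auto
  then show ?thesis
    unfolding Step_def using True u1
    by (intro wpI[OF exec.IfTrue[OF _ exec.Seq[OF e1 e2]]]) auto
qed

lemma wp_Finish:
  assumes inv: "loop_inv ds P T s"
  shows "wp Finish (\<lambda>u s'. u \<le> 2 * length ds + sum_list ds \<and>
    (nats s' ''case'' 0 = 1 \<and> perceptron_inv ds P T (reals s ''y'') (reals s ''Z'') \<and>
       nats s' ''k'' 0 < length ds \<and>
       (\<forall>i<length ds. reals s ''y'' (offset ds i) \<le> reals s ''y'' (offset ds (nats s' ''k'' 0))) \<and>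
       (\<forall>j<sum_list ds. reals s' ''out'' j = reals s ''y'' j / (real T + 1)) \<or>
     nats s' ''case'' 0 = 2 \<and> in_interior ds (reals s ''Z'') \<and>
       (\<exists>y. \<forall>i<sum_list ds. reals s ''Z'' i = app (sum_list ds) P y i) \<and>
       (\<forall>j<sum_list ds. reals s' ''out'' j = reals s ''Z'' j))) s"
proof (cases "nats s ''case'' 0 = 0")
  case False
  have L: "nats s ''N'' 0 = sum_list ds" using inv by (simp add: loop_inv_def layout_def)
  have "wp (For ''j'' (nv ''N'') (RAssign ''out'' (nv ''j'') (RCell ''Z'' (nv ''j''))))
      (\<lambda>u s'. u = 0 \<and> (\<forall>j<sum_list ds. reals s' ''out'' j = reals s ''Z'' j)) s"
    by (rule wp_array_update[where n = "sum_list ds" and g = "\<lambda>j. j" and f = "reals s ''Z''"])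
       (use L in \<open>auto simp: frame_def\<close>)
  then obtain s' where "exec (For ''j'' (nv ''N'') (RAssign ''out'' (nv ''j'') (RCell ''Z'' (nv ''j'')))) s 0 s'"
    "\<And>j. j < sum_list ds \<Longrightarrow> reals s' ''out'' j = reals s ''Z'' j" "nats s' ''case'' = nats s ''case''"
    by (rule wpE) (auto simp: frame_def)
  then show ?thesis
    unfolding Finish_def using inv False
    by (intro wpI[OF exec.IfFalse]) (auto simp: loop_inv_def)
next
  case True
  let ?y = "reals s ''y''" and ?n = "length ds"
  have L: "layout ds s" and pinv: "perceptron_inv ds P T ?y (reals s ''Z'')"
    using inv True by (auto simp: loop_inv_def)
  have sum: "(\<Sum>i<?n. ?y (offset ds i)) = real T + 1" using pinv by (simp add: perceptron_inv_def)
  \<comment> \<open>An empty sum could not be positive, so there is a block and index 0 is a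
    legitimate first candidate for the maximum.\<close>
  then have n: "0 < ?n" by (cases ds) auto
  let ?s1 = "nwrite ''case'' 0 1 s"
  let ?s2 = "nwrite ''k'' 0 0 ?s1"
  have e1: "exec (NAssign ''case'' (NNum 0) (NNum 1)) s 0 ?s1"
    using exec.NAssign[of "''case''" "NNum 0" "NNum 1" s] by simp
  have e2: "exec (NAssign ''k'' (NNum 0) (NNum 0)) ?s1 0 ?s2"
    using exec.NAssign[of "''k''" "NNum 0" "NNum 0" ?s1] by simp
  let ?body = "Seq (Compare ''f'' (NNum 0) (RCell ''y'' (NCell ''o'' (nv ''k''))) (RCell ''y'' (NCell ''o'' (nv ''i''))))
                 (If (BLess (NNum 0) (nv ''f'')) (NAssign ''k'' (NNum 0) (nv ''i'')) Skip)"
  let ?I = "\<lambda>i s'. nats s' ''k'' 0 < ?n \<and> (\<forall>b<i. ?y (offset ds b) \<le> ?y (offset ds (nats s' ''k'' 0)))"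
  have "wp (For ''i'' (nv ''n'') ?body) (\<lambda>u s'. u \<le> ?n \<and> ?I ?n s') ?s2"
  proof (rule wp_For[where n = ?n and B = 1 and I = ?I])
    fix i and s' :: store
    assume "i < ?n" "frame (insert ''i'' (mods ?body)) ?s2 s'" "nats s' ''i'' 0 = i" "?I i s'"
    moreover from this(2) have "layout ds s'" "reals s' ''y'' = ?y"
      using L by (auto simp: frame_def layout_def)
    ultimately show "wp ?body (\<lambda>u s''. u \<le> 1 \<and> ?I (Suc i) s'') s'"
      by (auto simp: wp_Seq wp_If layout_def less_Suc_eq)
  qed (use L n in \<open>auto simp: frame_def layout_def\<close>)
  then obtain u3 s3 where e3: "exec (For ''i'' (nv ''n'') ?body) ?s2 u3 s3" and u3: "u3 \<le> ?n"
    and I3: "?I ?n s3" and f3: "frame {''i'', ''k'', ''f''} ?s2 s3"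
    by (rule wpE) auto
  let ?s4 = "rwrite ''q'' 0 0 s3"
  have e4: "exec (RAssign ''q'' (NNum 0) (RNum 0)) s3 0 ?s4"
    using exec.RAssign[of s3 "RNum 0" "''q''" "NNum 0"] by simp
  let ?acc = "Accumulate ''i'' (nv ''n'') ''q'' (NNum 0) (RCell ''y'' (NCell ''o'' (nv ''i'')))"
  have "wp ?acc (\<lambda>u s'. u \<le> ?n \<and> reals s' ''q'' 0 = real T + 1) ?s4"
    by (rule wp_Accumulate[where n = ?n and l = 0 and f = "\<lambda>i. ?y (offset ds i)"])
       (use L f3 sum in \<open>auto simp: frame_def layout_def\<close>)
  then obtain u5 s5 where e5: "exec ?acc ?s4 u5 s5" and u5: "u5 \<le> ?n"
    and q: "reals s5 ''q'' 0 = real T + 1" and f5: "frame {''i'', ''q''} ?s4 s5"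
    by (rule wpE) auto
  let ?out = "For ''j'' (nv ''N'') (RAssign ''out'' (nv ''j'') (RDiv (RCell ''y'' (nv ''j'')) (rv ''q'')))"
  have "wp ?out (\<lambda>u s'. u \<le> sum_list ds \<and> (\<forall>j<sum_list ds. reals s' ''out'' j = ?y j / (real T + 1))) s5"
    by (rule wp_array_update[where n = "sum_list ds" and g = "\<lambda>j. j" and f = "\<lambda>j. ?y j / (real T + 1)"])
       (use L f3 f5 q in \<open>auto simp: frame_def layout_def\<close>)
  then obtain u6 s6 where e6: "exec ?out s5 u6 s6" and u6: "u6 \<le> sum_list ds"
    and out: "\<And>j. j < sum_list ds \<Longrightarrow> reals s6 ''out'' j = ?y j / (real T + 1)"
    and f6: "frame {''j'', ''out''} s5 s6"
    by (rule wpE) auto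
  have "nats s6 ''case'' 0 = 1" "nats s6 ''k'' = nats s3 ''k''"
    using f3 f5 f6 by (auto simp: frame_def)
  then show ?thesis
    unfolding Finish_def using True u3 u5 u6 out I3 pinv
    by (intro wpI[OF exec.IfTrue[OF _ exec.Seq[OF e1 exec.Seq[OF e2 exec.Seq[OF e3 exec.Seq[OF e4
        exec.Seq[OF e5 e6]]]]]]]) auto
qed

section \<open>Total operation count and assembly\<close>

lemma sum_list_le_length_mult: "(\<And>d. d \<in> set ds \<Longrightarrow> d \<le> D) \<Longrightarrow> sum_list ds \<le> length ds * (D :: nat)"
  by (induction ds) (auto simp: add_mono)

lemma length_le_sum_list: "\<forall>d\<in>set ds. d \<ge> 1 \<Longrightarrow> length ds \<le> sum_list ds"
  by (induction ds) auto

text \<open>With \<open>X = n^3 * N * D\<close>: the projection needs at most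
  \<open>7 * m * N^2\<close>, the first product \<open>2 * X\<close> because
  \<open>N <= n * D\<close>, the main loop \<open>88 * X\<close> because each step costs at most
  \<open>11 * N * D\<close>, and the final phase \<open>3 * X\<close>. The constant 100 is a round
  number above these.\<close>

lemma cost_bound:
  fixes n N D m :: nat
  assumes "1 \<le> n" "1 \<le> D" "n \<le> N" "N \<le> n * D"
  shows "m * (5 * N\<^sup>2 + 2 * N) + N * (N * 2) + 8 * n ^ 3 * (n * (2 * D + 3) + (1 + 3 * D + 2 * N * D))
      + (2 * n + N) \<le> 100 * (n ^ 3 * N * D + m * N\<^sup>2)"
proof -
  let ?X = "n ^ 3 * N * D"
  have n3: "n \<le> n ^ 3" "1 \<le> n ^ 3" using assms(1) by (simp_all add: self_le_power)
  have "N \<le> N\<^sup>2" using assms by (simp add: power2_eq_square)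
  then have "m * (5 * N\<^sup>2 + 2 * N) \<le> m * (7 * N\<^sup>2)" by (intro mult_le_mono2) simp
  then have c1: "m * (5 * N\<^sup>2 + 2 * N) \<le> 7 * (m * N\<^sup>2)" by simp
  have "N * N \<le> (n * D) * N" using assms(4) by simp
  also have "\<dots> \<le> (n ^ 3 * D) * N" using n3(1) by simp
  finally have c2: "N * N \<le> ?X" by (simp add: mult_ac)
  have nD: "n \<le> n * D" "n * D \<le> N * D" "D \<le> N * D" using assms by simp_all
  have "n * (2 * D + 3) + (1 + 3 * D + 2 * N * D) = 2 * (n * D) + 3 * n + 1 + 3 * D + 2 * (N * D)"
    by (simp add: algebra_simps)
  also have "\<dots> \<le> 11 * (N * D)" using nD assms(2) by linarith
  finally have "8 * n ^ 3 * (n * (2 * D + 3) + (1 + 3 * D + 2 * N * D)) \<le> 8 * n ^ 3 * (11 * (N * D))"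
    by (rule mult_le_mono2)
  then have c3: "8 * n ^ 3 * (n * (2 * D + 3) + (1 + 3 * D + 2 * N * D)) \<le> 88 * ?X" by (simp add: mult_ac)
  have "N \<le> ?X"
    using mult_le_mono[OF mult_le_mono[OF n3(2) order_refl] assms(2), of N] unfolding mult_1 mult_1_right .
  then have c4: "2 * n + N \<le> 3 * ?X" using assms(3) by linarith
  show ?thesis using c1 c2 c3 c4 unfolding distrib_left by linarith
qed

lemma Basic_Procedure_correct:
  assumes valid: "valid_input ds m A y_in"
  defines "n \<equiv> length ds" and "N \<equiv> sum_list ds" and "D \<equiv> Max (set ds)"
  shows "wp Basic_Procedure (\<lambda>t s. t \<le> 100 * (n ^ 3 * N * D + m * N\<^sup>2) \<and>
      (output_case s = 1 \<and> cut_generating ds A (output_vec N s) (output_index s) \<or>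
       output_case s = 2 \<and> output_vec N s \<in> vec_interior N (cone ds) \<and> A *\<^sub>v output_vec N s = 0\<^sub>v m))
    (input_store ds A y_in)"
proof -
  have ds: "\<forall>d\<in>set ds. d \<ge> 1" and A: "A \<in> carrier_mat m N" and li: "lin_indep_rows A"
    and y_in: "y_in \<in> vec_interior N (cone ds)" "cone_unit ds \<bullet> y_in = 1"
    using valid by (auto simp: valid_input_def N_def)
  have y_dim: "y_in \<in> carrier_vec N" and y_int: "in_interior ds (\<lambda>j. y_in $ j)"
    using y_in(1) interior_cone_iff[OF ds] by (auto simp: N_def)
  have y_sum: "(\<Sum>i<n. y_in $ offset ds i) = 1"
    using cone_unit_scalar_prod[OF ds] y_dim y_in(2) by (simp add: N_def n_def)
  \<comment> \<open>The normalisation \<open>e^T y = 1\<close> rules out the empty product of cones,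
    so \<open>D\<close> is the maximum of a nonempty set.\<close>
  then have n: "1 \<le> n" by (cases n) auto
  have D: "d \<le> D" if "d \<in> set ds" for d using that by (simp add: D_def)
  then have D': "ds ! i \<le> D" if "i < length ds" for i using that by simp
  have D1: "1 \<le> D" using D'[of 0] n ds by (metis One_nat_def Suc_le_eq le_trans n_def nth_mem)
  let ?s = "input_store ds A y_in"
  let ?a = "\<lambda>r j. A $$ (r, j)"
  let ?P = "row_proj N ?a m"
  have P: "orth_proj N ?P" by (rule orth_proj_row_proj)
  have in_n: "nats ?s ''n'' 0 = length ds" "nats ?s ''m'' 0 = m" "nats ?s ''N'' 0 = 0"
    "nats ?s ''case'' 0 = 0" "\<And>i. i < length ds \<Longrightarrow> nats ?s ''d'' i = ds ! i"
    using A by (auto simp: input_store_def)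
  have in_A: "reals ?s ''A'' (r * N + j) = ?a r j" if "r < m" "j < N" for r j
  proof -
    have "Suc r * N \<le> m * N" using that by (intro mult_le_mono1) simp
    then have "r * N + j < m * N" using that by simp
    then show ?thesis using A that by (simp add: input_store_def)
  qed
  have in_y: "reals ?s ''y'' j = y_in $ j" if "j < N" for j
    using that y_dim by (simp add: input_store_def)
  have in_0: "reals ?s ''P'' x = 0" "reals ?s ''Z'' x = 0" for x
    by (simp_all add: input_store_def)
  obtain s1 where e1: "exec Offsets ?s 0 s1" and L1: "layout ds s1" and f1: "frame (mods Offsets) ?s s1"
    using wp_Offsets[OF in_n(1,3,5)] by (rule wpE) auto
  have s1: "nats s1 ''N'' 0 = N" "nats s1 ''m'' 0 = m" "nats s1 ''case'' 0 = 0" "reals s1 ''A'' = reals ?s ''A''"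
    "reals s1 ''y'' = reals ?s ''y''" "reals s1 ''P'' = reals ?s ''P''" "reals s1 ''Z'' = reals ?s ''Z''"
    using L1 f1 in_n by (auto simp: Offsets_def frame_def layout_def N_def)
  have "wp Projection (\<lambda>t s'. t \<le> m * (5 * N\<^sup>2 + 2 * N) \<and> holds_matrix N ?P s') s1"
    using s1 in_A in_0 by (intro wp_Projection lin_indep_rows_coeffs[OF A li]) auto
  then obtain t2 s2 where e2: "exec Projection s1 t2 s2" and t2: "t2 \<le> m * (5 * N\<^sup>2 + 2 * N)"
    and P2: "holds_matrix N ?P s2" and f2: "frame (mods Projection) s1 s2"
    by (rule wpE) auto
  have s2: "nats s2 ''case'' 0 = 0" "layout ds s2" "reals s2 ''y'' = reals ?s ''y''" "reals s2 ''Z'' = reals ?s ''Z''"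
    using s1 L1 f2 by (auto simp: Projection_def Identity_def Deflate_def frame_def layout_def)
  have "wp InitZ (\<lambda>t s'. t \<le> N * (N * 2) \<and> (\<forall>i<N. reals s' ''Z'' i = app N ?P (reals s2 ''y'') i)) s2"
    using s2 in_0 by (intro wp_InitZ[OF _ P2]) (auto simp: layout_def N_def)
  then obtain t3 s3 where e3: "exec InitZ s2 t3 s3" and t3: "t3 \<le> N * (N * 2)"
    and Z3: "\<And>i. i < N \<Longrightarrow> reals s3 ''Z'' i = app N ?P (reals s2 ''y'') i" and f3: "frame (mods InitZ) s2 s3"
    by (rule wpE) auto
  have s3: "nats s3 ''case'' 0 = 0" "layout ds s3" "holds_matrix N ?P s3" "reals s3 ''y'' = reals ?s ''y''"
    using s2 P2 f3 by (auto simp: InitZ_def frame_def layout_def holds_matrix_def)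
  have "perceptron_inv ds ?P 0 (reals s3 ''y'') (reals s3 ''Z'')"
  proof (rule perceptron_inv_init[OF ds])
    show "in_interior ds (reals s3 ''y'')"
      using y_int in_interior_cong[OF ds, of "reals s3 ''y''" "\<lambda>j. y_in $ j"] in_y by (simp add: s3(4) N_def)
    show "(\<Sum>i<length ds. reals s3 ''y'' (offset ds i)) = 1"
      using y_sum in_y offset_less[OF ds] by (simp add: s3(4) N_def n_def)
  qed (use P Z3 s2 s3 in \<open>auto simp: N_def\<close>)
  then have inv3: "loop_inv ds ?P 0 s3" using s3 by (simp add: loop_inv_def N_def)
  let ?T = "8 * n ^ 3" and ?B = "n * (2 * D + 3) + (1 + 3 * D + 2 * N * D)"
  let ?loop = "For ''t'' (NMul (NNum 8) (NMul (nv ''n'') (NMul (nv ''n'') (nv ''n'')))) Step"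
  have "wp ?loop (\<lambda>t s'. t \<le> ?T * ?B \<and> loop_inv ds ?P ?T s') s3"
  proof (rule wp_For[where n = ?T and B = ?B and I = "loop_inv ds ?P"])
    show "wp Step (\<lambda>t s''. t \<le> ?B \<and> loop_inv ds ?P (Suc i) s'') s'" if "loop_inv ds ?P i s'" for i s'
      using wp_Step[OF ds D', of ?P i s'] P that by (simp add: N_def n_def)
    show "loop_inv ds ?P i (nwrite ''t'' 0 x s') = loop_inv ds ?P i s'" for i x s'
      by (simp add: loop_inv_def layout_def holds_matrix_def)
  qed (use s3 inv3 in \<open>auto simp: frame_def layout_def Step_def Find_def Update_def n_def power3_eq_cube\<close>)
  then obtain t4 s4 where e4: "exec ?loop s3 t4 s4" and t4: "t4 \<le> ?T * ?B" and inv4: "loop_inv ds ?P ?T s4"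
    by (rule wpE) auto
  obtain t5 s5 where e5: "exec Finish s4 t5 s5" and t5: "t5 \<le> 2 * n + N"
    and res: "nats s5 ''case'' 0 = 1 \<and> perceptron_inv ds ?P ?T (reals s4 ''y'') (reals s4 ''Z'') \<and>
       nats s5 ''k'' 0 < length ds \<and>
       (\<forall>i<length ds. reals s4 ''y'' (offset ds i) \<le> reals s4 ''y'' (offset ds (nats s5 ''k'' 0))) \<and>
       (\<forall>j<N. reals s5 ''out'' j = reals s4 ''y'' j / (real ?T + 1)) \<or>
     nats s5 ''case'' 0 = 2 \<and> in_interior ds (reals s4 ''Z'') \<and>
       (\<exists>y. \<forall>i<N. reals s4 ''Z'' i = app N ?P y i) \<and>
       (\<forall>j<N. reals s5 ''out'' j = reals s4 ''Z'' j)"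
    using wp_Finish[OF inv4] unfolding N_def[symmetric] n_def[symmetric] by (rule wpE) blast
  have cost: "0 + (t2 + (t3 + (t4 + t5))) \<le> 100 * (n ^ 3 * N * D + m * N\<^sup>2)"
    using t2 t3 t4 t5 cost_bound[OF n D1, of N m] length_le_sum_list[OF ds] sum_list_le_length_mult[of ds D] D
    by (simp add: N_def n_def)
  have "output_case s5 = 1 \<and> cut_generating ds A (output_vec N s5) (output_index s5) \<or>
       output_case s5 = 2 \<and> output_vec N s5 \<in> vec_interior N (cone ds) \<and> A *\<^sub>v output_vec N s5 = 0\<^sub>v m"
    using res
  proof
    assume r: "nats s5 ''case'' 0 = 1 \<and> perceptron_inv ds ?P ?T (reals s4 ''y'') (reals s4 ''Z'') \<and>
       nats s5 ''k'' 0 < length ds \<and>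
       (\<forall>i<length ds. reals s4 ''y'' (offset ds i) \<le> reals s4 ''y'' (offset ds (nats s5 ''k'' 0))) \<and>
       (\<forall>j<N. reals s5 ''out'' j = reals s4 ''y'' j / (real ?T + 1))"
    then have "cut_generating ds A (output_vec N s5) (output_index s5)"
      using A li by (intro cut_generating_final[of ds A m ?T "reals s4 ''y''" "reals s4 ''Z''", OF ds])
        (auto simp: N_def n_def output_vec_def output_index_def)
    with r show ?thesis by (simp add: output_case_def)
  next
    assume r: "nats s5 ''case'' 0 = 2 \<and> in_interior ds (reals s4 ''Z'') \<and>
       (\<exists>y. \<forall>i<N. reals s4 ''Z'' i = app N ?P y i) \<and>
       (\<forall>j<N. reals s5 ''out'' j = reals s4 ''Z'' j)"
    then obtain y where "\<And>i. i < N \<Longrightarrow> reals s4 ''Z'' i = app N ?P y i" by blast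
    with r A have "output_vec N s5 \<in> vec_interior N (cone ds) \<and> A *\<^sub>v output_vec N s5 = 0\<^sub>v m"
      unfolding N_def by (intro kernel_final[of ds A m "reals s4 ''Z''" y, OF ds]) (auto simp: output_vec_def)
    with r show ?thesis by (simp add: output_case_def)
  qed
  with cost show ?thesis
    unfolding Basic_Procedure_def
    by (intro wpI[OF exec.Seq[OF e1 exec.Seq[OF e2 exec.Seq[OF e3 exec.Seq[OF e4 e5]]]]]) blast
qed

theorem mainTheorem2:
  "\<exists>(C::real) > 0. \<exists>basic_procedure :: com.
     \<forall>(ds :: nat list) (m :: nat) (A :: real mat) (y_in :: real vec).
       valid_input ds m A y_in \<longrightarrow>
       (let n = length ds; N = sum_list ds; K = cone ds in
        \<exists>t s. exec basic_procedure (input_store ds A y_in) t s \<and>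
          real t \<le> C * (real n ^ 3 * real N * real (Max (set ds)) + real m * real N ^ 2) \<and>
          (let v = output_vec N s in
             output_case s = 1 \<and> cut_generating ds A v (output_index s)
           \<or> output_case s = 2 \<and> v \<in> vec_interior N K \<and> A *\<^sub>v v = 0\<^sub>v m
           \<or> output_case s = 3 \<and> v \<in> K \<and> v \<noteq> 0\<^sub>v N \<and> (\<exists>u \<in> carrier_vec m. v = A\<^sup>T *\<^sub>v u)))"
proof (rule exI[of _ 100], intro conjI exI[of _ Basic_Procedure] allI impI)
  fix ds :: "nat list" and m and A :: "real mat" and y_in :: "real vec"
  let ?n = "length ds" and ?N = "sum_list ds" and ?D = "Max (set ds)"
  assume "valid_input ds m A y_in"
  from Basic_Procedure_correct[OF this]
  obtain t s where e: "exec Basic_Procedure (input_store ds A y_in) t s"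
    and t: "t \<le> 100 * (?n ^ 3 * ?N * ?D + m * ?N\<^sup>2)"
    and out: "output_case s = 1 \<and> cut_generating ds A (output_vec ?N s) (output_index s) \<or>
       output_case s = 2 \<and> output_vec ?N s \<in> vec_interior ?N (cone ds) \<and> A *\<^sub>v output_vec ?N s = 0\<^sub>v m"
    by (rule wpE) blast
  have "real t \<le> real (100 * (?n ^ 3 * ?N * ?D + m * ?N\<^sup>2))" using t by (rule of_nat_mono)
  then have "real t \<le> 100 * (real ?n ^ 3 * real ?N * real ?D + real m * real ?N ^ 2)" by simp
  with e out show "let n = length ds; N = sum_list ds; K = cone ds in
        \<exists>t s. exec Basic_Procedure (input_store ds A y_in) t s \<and>
          real t \<le> 100 * (real n ^ 3 * real N * real (Max (set ds)) + real m * real N ^ 2) \<and>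
          (let v = output_vec N s in
             output_case s = 1 \<and> cut_generating ds A v (output_index s)
           \<or> output_case s = 2 \<and> v \<in> vec_interior N K \<and> A *\<^sub>v v = 0\<^sub>v m
           \<or> output_case s = 3 \<and> v \<in> K \<and> v \<noteq> 0\<^sub>v N \<and> (\<exists>u \<in> carrier_vec m. v = A\<^sup>T *\<^sub>v u))"
    unfolding Let_def by blast
qed simp

end
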